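(* Let $\mathbb G$ be a Carnot group of step 2 with Carnot–Carathéodory distance $d$, and let $d_0 := d(\cdot,0)$. Then $d_0^2$ is h-semiconcave in $\mathbb G$: there exists a constant $C\ge 0$ such that $$d_0^2(p\cdot h)+d_0^2(p\cdot h^{-1})-2d_0^2(p)\le C|h|^2\quad\text{for all } p\in\mathbb G,\ h\in\mathcal H_0.$$
   Context: A step 2 Carnot group $\mathbb G$ is a connected, simply connected Lie group whose Lie algebra splits as $\mathfrak g=\mathfrak g_1\oplus\mathfrak g_2$ with $[\mathfrak g_1,\mathfrak g_1]=\mathfrak g_2\neq\{0\}$ and $[\mathfrak g_1,\mathfrak g_2]=\{0\}$. Via exponential coordinates $\mathbb G$ is identified with $\mathbb R^n=\mathbb R^m\times\mathbb R^{n_2}$ ($m=\dim\mathfrak g_1$), writing $p=(p^{(1)},p^{(2)})$, with group law $p\cdot q=(p^{(1)}+q^{(1)},\,p^{(2)}+q^{(2)}+\mathcal B(p^{(1)},q^{(1)}))$ for a skew-symmetric bilinear map $\mathcal B:\mathbb R^m\times\mathbb R^m\to\mathbb R^{n_2}$; the identity is $0$ and $p^{-1}=-p$. Let $X_1,\dots,X_m$ be the left-invariant vector fields agreeing with $\partial/\partial p_i$ at $0$. A horizontal curve is an absolutely continuous $\gamma:[0,1]\to\mathbb G$ with $\dot\gamma(\tau)=\sum_{i=1}^m u_i(\tau)X_i(\gamma(\tau))$ a.e.; its length is $\int_0^1|u(\tau)|\,d\tau$. The Carnot–Carathéodory (CC) distance $d(p,q)$ is the infimum of lengths of horizontal curves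 from $p$ to $q$. The horizontal plane is $\mathcal H_0=\mathbb R^m\times\{0\}\subset\mathbb G$. $|\cdot|$ is the Euclidean norm on $\mathbb R^n$. For an open $\Omega\subset\mathbb G$, a lower semicontinuous $u:\Omega\to\mathbb R$ is h-semiconcave in $\Omega$ if there is $C\ge0$ with $u(p\cdot h)+u(p\cdot h^{-1})-2u(p)\le C|h|^2$ for all $p\in\Omega$, $h\in\mathcal H_0$ such that $\{p\cdot\tau h:\tau\in[-1,1]\}\subset\Omega$. *)

theory Defs
  imports "HOL-Analysis.Analysis"
begin

text \<open>Step 2 Carnot groups in exponential coordinates: points are pairs
  (p1, p2) in real^'m x real^'k (so m = CARD('m), n2 = CARD('k)); the
  Euclidean norm on the product type is the Euclidean norm of R^n.
  The group structure is given by a skew-symmetric bilinear map B whose image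
  spans the second layer (i.e. [g1,g1] = g2; g2 is nonzero since 'k is nonempty).\<close>

type_synonym ('m, 'k) cpt = "(real ^ 'm) \<times> (real ^ 'k)"

definition step2_carnot :: "(real ^ 'm \<Rightarrow> real ^ 'm \<Rightarrow> real ^ 'k) \<Rightarrow> bool" where
  "step2_carnot B \<longleftrightarrow> bilinear B \<and> (\<forall>x y. B x y = - B y x) \<and>
     span (range (\<lambda>(x, y). B x y)) = UNIV"

definition gmult :: "(real ^ 'm \<Rightarrow> real ^ 'm \<Rightarrow> real ^ 'k) \<Rightarrow> ('m, 'k) cpt \<Rightarrow> ('m, 'k) cpt \<Rightarrow> ('m, 'k) cpt" where
  "gmult B p q = (fst p + fst q, snd p + snd q + B (fst p) (fst q))"

text \<open>Left-invariant vector field X_i, agreeing with d/dp_i at 0: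
  X_i(p) = d/dt (p . t e_i) at t = 0.\<close>
definition Xfield :: "(real ^ 'm \<Rightarrow> real ^ 'm \<Rightarrow> real ^ 'k) \<Rightarrow> 'm \<Rightarrow> ('m, 'k) cpt \<Rightarrow> ('m, 'k) cpt" where
  "Xfield B i p = (axis i 1, B (fst p) (axis i 1))"

definition abs_cont_on :: "real \<Rightarrow> real \<Rightarrow> (real \<Rightarrow> 'a::metric_space) \<Rightarrow> bool" where
  "abs_cont_on a b f \<longleftrightarrow> (\<forall>\<epsilon>>0. \<exists>\<delta>>0. \<forall>(n::nat) (l::nat \<Rightarrow> real) (r::nat \<Rightarrow> real).
      (\<forall>k<n. a \<le> l k \<and> l k \<le> r k \<and> r k \<le> b) \<and>
      (\<forall>k<n. \<forall>j<n. k \<noteq> j \<longrightarrow> r k \<le> l j \<or> r j \<le> l k) \<and>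
      (\<Sum>k<n. r k - l k) < \<delta> \<longrightarrow> (\<Sum>k<n. dist (f (r k)) (f (l k))) < \<epsilon>)"

text \<open>gamma is a horizontal curve with control u (u integrable on [0,1], so that
  the length is finite; curves of infinite length do not affect the infimum).\<close>
definition horizontal_curve ::
  "(real ^ 'm \<Rightarrow> real ^ 'm \<Rightarrow> real ^ 'k) \<Rightarrow> (real \<Rightarrow> ('m, 'k) cpt) \<Rightarrow> (real \<Rightarrow> real ^ 'm) \<Rightarrow> bool" where
  "horizontal_curve B \<gamma> u \<longleftrightarrow> abs_cont_on 0 1 \<gamma> \<and>
     integrable (lebesgue_on {0..1}) u \<and>
     (AE t in lebesgue_on {0..1}.
        (\<gamma> has_vector_derivative (\<Sum>i\<in>UNIV. u t $ i *\<^sub>R Xfield B i (\<gamma> t))) (at t within {0..1}))"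

definition curve_length :: "(real \<Rightarrow> real ^ 'm) \<Rightarrow> real" where
  "curve_length u = integral\<^sup>L (lebesgue_on {0..1}) (\<lambda>t. norm (u t))"

definition cc_dist :: "(real ^ 'm \<Rightarrow> real ^ 'm \<Rightarrow> real ^ 'k) \<Rightarrow> ('m, 'k) cpt \<Rightarrow> ('m, 'k) cpt \<Rightarrow> real" where
  "cc_dist B p q = Inf {curve_length u | \<gamma> u. horizontal_curve B \<gamma> u \<and> \<gamma> 0 = p \<and> \<gamma> 1 = q}"

definition horizontal_plane :: "((real ^ 'm::finite) \<times> (real ^ 'k::finite)) set" where
  "horizontal_plane = {h. snd h = 0}"

definition lsc_on :: "'a::topological_space set \<Rightarrow> ('a \<Rightarrow> real) \<Rightarrow> bool" where
  "lsc_on \<Omega> f \<longleftrightarrow> (\<forall>p\<in>\<Omega>. \<forall>c. c < f p \<longrightarrow> (\<forall>\<^sub>F q in at p within \<Omega>. c < f q))"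

text \<open>h-semiconcavity in an open set Omega (inverse of h is -h).\<close>
definition h_semiconcave ::
  "(real ^ 'm \<Rightarrow> real ^ 'm \<Rightarrow> real ^ 'k) \<Rightarrow> ('m, 'k) cpt set \<Rightarrow> (('m, 'k) cpt \<Rightarrow> real) \<Rightarrow> bool" where
  "h_semiconcave B \<Omega> f \<longleftrightarrow> lsc_on \<Omega> f \<and>
     (\<exists>C\<ge>0. \<forall>p\<in>\<Omega>. \<forall>h\<in>horizontal_plane.
        (\<forall>\<tau>\<in>{-1..1}. gmult B p (\<tau> *\<^sub>R h) \<in> \<Omega>) \<longrightarrow>
        f (gmult B p h) + f (gmult B p (- h)) - 2 * f p \<le> C * (norm h)\<^sup>2)"

end

theory Submission
  imports Defs
begin

text \<open>
  Let \<open>E(u)\<close> be the energy of a control \<open>u\<close>, so that \<open>d\<^sub>0\<^sup>2(p)\<close> is the infimum of \<open>E\<close> over the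
  controls steering \<open>p\<close> to \<open>0\<close>. Adding \<open>y'\<close> to \<open>u\<close>, with \<open>y(1) = 0\<close>, moves the starting point from \<open>p\<close>
  to \<open>p \<cdot> y(0)\<close> up to the vertical error \<open>- 2 \<integral> B(y, u) - \<integral> B(y, y')\<close>.

  First, \<open>d\<^sub>0\<^sup>2\<close> is globally Lipschitz in the vertical variable: for loops \<open>y = a e + b f\<close> whose linear
  term \<open>\<integral> B(y, u)\<close> vanishes (finitely many linear conditions on \<open>a\<close> and \<open>b\<close>), both \<open>y\<close> and \<open>- y\<close> produce the
  same vertical displacement, of the order of \<open>E(y')\<close>, and one of the two signs does not increase the
  energy to first order.

  Secondly, the Lipschitz bound forces the moments \<open>U(\<theta>) = \<integral> \<theta> u\<close> of a minimizing sequence to satisfy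
  in the limit \<open>U(\<theta>') = A U(\<theta>)\<close> with a skew matrix \<open>A\<close> bounded independently of \<open>p\<close>; this is a weak form
  of the equation of normal extremals. As \<open>A\<^sup>2\<close> is symmetric, \<open>\<Prod>\<^sub>i (A\<^sup>2 - \<mu>\<^sub>i) = 0\<close> for bounded \<open>\<mu>\<^sub>i\<close>, so the
  function \<open>\<phi>\<close> obtained by applying \<open>\<Prod>\<^sub>i (D\<^sup>2 - \<mu>\<^sub>i)\<close> to a fixed polynomial that vanishes to high order at the
  end points satisfies \<open>U(\<phi>) = 0\<close>, \<open>\<phi>(0) = 1\<close> and \<open>\<phi>(1) = 0\<close>, with \<open>\<phi>'\<close> bounded independently of \<open>p\<close>.
  The perturbations \<open>y = \<plusminus> \<phi> h\<close> then have no vertical error, and adding the two energies gives the claim.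
\<close>

section \<open>Absolutely continuous functions\<close>

text \<open>The gauge integral gives this directly: at tags outside \<open>N\<close>
  differentiability controls each piece, while the pieces tagged in \<open>N\<close> lie in an open
  set of small measure, where absolute continuity bounds the sum of the increments of
  \<open>f\<close>.\<close>

lemma abs_cont_on_FTC:
  fixes f :: "real \<Rightarrow> 'a::banach"
  assumes ac: "abs_cont_on a b f" and ab: "a \<le> b" and N: "negligible N"
    and der: "\<And>t. t \<in> {a..b} - N \<Longrightarrow> (f has_vector_derivative f' t) (at t within {a..b})"
  shows "(f' has_integral (f b - f a)) {a..b}"
proof -
  \<comment> \<open>With the value 0 on \<open>N\<close>, a piece tagged in \<open>N\<close>
    contributes only the increment of \<open>f\<close>.\<close>
  define g where "g t = (if t \<in> N then 0 else f' t)" for t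
  have "(g has_integral (f b - f a)) {a..b}"
    unfolding has_integral_real
  proof (intro allI impI)
    fix e :: real assume e: "e > 0"
    define c where "c = e / (2 * (b - a + 1))"
    have c: "c > 0" using e ab by (simp add: c_def)
    have cab: "c * (b - a) < e / 2"
      using e ab by (simp add: c_def field_simps)
    obtain \<delta> where \<delta>: "\<delta> > 0" and acd: "\<And>(n::nat) (l::nat \<Rightarrow> real) (r::nat \<Rightarrow> real).
      \<lbrakk>\<forall>k<n. a \<le> l k \<and> l k \<le> r k \<and> r k \<le> b;
      \<forall>k<n. \<forall>j<n. k \<noteq> j \<longrightarrow> r k \<le> l j \<or> r j \<le> l k;
      (\<Sum>k<n. r k - l k) < \<delta>\<rbrakk> \<Longrightarrow> (\<Sum>k<n. dist (f (r k)) (f (l k))) < e/2"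
    proof -
      from ac[unfolded abs_cont_on_def, rule_format, of "e/2"] e
      obtain \<delta> where "\<delta> > 0" and *: "\<forall>(n::nat) (l::nat \<Rightarrow> real) (r::nat \<Rightarrow> real).
        (\<forall>k<n. a \<le> l k \<and> l k \<le> r k \<and> r k \<le> b) \<and>
        (\<forall>k<n. \<forall>j<n. k \<noteq> j \<longrightarrow> r k \<le> l j \<or> r j \<le> l k) \<and>
        (\<Sum>k<n. r k - l k) < \<delta> \<longrightarrow> (\<Sum>k<n. dist (f (r k)) (f (l k))) < e/2"
        by auto
      show thesis
        by (rule that[OF \<open>\<delta> > 0\<close>]) (rule *[rule_format], intro conjI; assumption)
    qed
    have "N \<in> sets lebesgue" "emeasure lebesgue N = 0"
      using N by (auto simp: negligible_iff_null_sets null_setsD1 null_setsD2)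
    then obtain U where U: "open U" "N \<subseteq> U" "(U - N) \<in> lmeasurable" "emeasure lebesgue (U - N) < ennreal \<delta>"
      using sets_lebesgue_outer_open[OF _ \<delta>] by blast
    have Um: "U \<in> lmeasurable"
      using fmeasurable.Un[OF U(3) negligible_imp_measurable[OF N]] U(2) by (simp add: Un_absorb2)
    have UN: "negligible ((U - N) - U \<union> (U - (U - N)))"
      by (rule negligible_subset[OF N]) auto
    have "measure lebesgue (U - N) = measure lebesgue U"
      using measure_negligible_symdiff[OF U(3) UN] by simp
    then have Ud: "measure lebesgue U < \<delta>"
      using U(4) by (simp add: emeasure_eq_measure2[OF U(3)] ennreal_less_iff)
    have "\<exists>r>0. \<forall>s\<in>{a..b}. \<bar>s - t\<bar> < r \<longrightarrow> norm (f s - f t - (s - t) *\<^sub>R f' t) \<le> c * \<bar>s - t\<bar>"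
      if "t \<in> {a..b} - N" for t
      using der[OF that, unfolded has_vector_derivative_def has_derivative_within_alt, THEN conjunct2, rule_format, OF c]
      by (simp add: real_norm_def)
    then obtain r where r: "\<And>t. t \<in> {a..b} - N \<Longrightarrow> r t > 0"
      "\<And>t s. t \<in> {a..b} - N \<Longrightarrow> s \<in> {a..b} \<Longrightarrow> \<bar>s - t\<bar> < r t \<Longrightarrow> norm (f s - f t - (s - t) *\<^sub>R f' t) \<le> c * \<bar>s - t\<bar>"
      by (metis (full_types))
    \<comment> \<open>Pieces tagged in \<open>N\<close> are confined to \<open>U\<close>, the others
      to the differentiability radius; the unit ball outside the interval only makes
      \<open>G\<close> a gauge.\<close>
    define G where "G t = (if t \<in> N then U else if t \<in> {a..b} then ball t (r t) else ball t 1)" for t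
    have "gauge G"
      using U r(1) by (auto simp: gauge_def G_def)
    moreover have "norm ((\<Sum>(x,k)\<in>p. measure lborel k *\<^sub>R g x) - (f b - f a)) < e"
      if p: "p tagged_division_of {a..b}" and fine: "G fine p" for p
    proof -
      note pD = tagged_division_ofD[OF p]
      have pk: "\<exists>l r. k = {l..r} \<and> a \<le> l \<and> l \<le> x \<and> x \<le> r \<and> r \<le> b" if xk: "(x,k) \<in> p" for x k
      proof -
        obtain l r where k: "k = cbox l r" using pD(4)[OF xk] by blast
        have "x \<in> k" by (rule pD(2)[OF xk])
        with k have "l \<le> x" "x \<le> r" by auto
        moreover have "l \<in> {a..b}" "r \<in> {a..b}" using pD(3)[OF xk] k \<open>x \<in> k\<close> by auto
        ultimately show ?thesis using k by auto
      qed
      let ?F = "\<lambda>(x,k). measure lborel k *\<^sub>R g x - (f (Sup k) - f (Inf k))"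
      have "(\<Sum>(x,k)\<in>p. measure lborel k *\<^sub>R g x) - (f b - f a) = (\<Sum>z\<in>p. ?F z)"
        using additive_tagged_division_1[OF ab p, of f]
        by (simp add: sum_subtractf case_prod_unfold)
      also have "\<dots> = (\<Sum>z\<in>{z\<in>p. fst z \<notin> N}. ?F z) + (\<Sum>z\<in>{z\<in>p. fst z \<in> N}. ?F z)"
        using pD(1) by (subst sum.union_disjoint[symmetric]) (auto intro: sum.cong)
      \<comment> \<open>Degenerate intervals contribute nothing and are dropped: disjointness of
        interiors says nothing about where they lie, whereas absolute continuity is stated for
        intervals that do not overlap.\<close>
      also have "(\<Sum>z\<in>{z\<in>p. fst z \<in> N}. ?F z) = (\<Sum>z\<in>{z\<in>p. fst z \<in> N \<and> measure lborel (snd z) \<noteq> 0}. ?F z)"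
      proof (rule sum.mono_neutral_right)
        show "\<forall>i\<in>{z \<in> p. fst z \<in> N} - {z \<in> p. fst z \<in> N \<and> measure lborel (snd z) \<noteq> 0}. ?F i = 0"
        proof
          fix z assume z: "z \<in> {z \<in> p. fst z \<in> N} - {z \<in> p. fst z \<in> N \<and> measure lborel (snd z) \<noteq> 0}"
          then have "(fst z, snd z) \<in> p" by simp
          from pk[OF this] z show "?F z = 0" by (auto simp: case_prod_unfold)
        qed
      qed (use pD(1) in auto)
      finally have eq: "(\<Sum>(x,k)\<in>p. measure lborel k *\<^sub>R g x) - (f b - f a) =
         (\<Sum>z\<in>{z\<in>p. fst z \<notin> N}. ?F z) + (\<Sum>z\<in>{z\<in>p. fst z \<in> N \<and> measure lborel (snd z) \<noteq> 0}. ?F z)" .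
      have "norm (\<Sum>z\<in>{z\<in>p. fst z \<notin> N}. ?F z) \<le> (\<Sum>z\<in>{z\<in>p. fst z \<notin> N}. c * measure lborel (snd z))"
      proof (rule sum_norm_le)
        fix z assume z: "z \<in> {z\<in>p. fst z \<notin> N}"
        obtain x k where zx: "z = (x,k)" by (cases z)
        with z have xk: "(x,k) \<in> p" "x \<notin> N" by auto
        obtain l q where k: "k = {l..q}" "a \<le> l" "l \<le> x" "x \<le> q" "q \<le> b" using pk[OF xk(1)] by auto
        have "k \<subseteq> ball x (r x)" using fineD[OF fine xk(1)] xk k by (simp add: G_def)
        then have lq: "\<bar>l - x\<bar> < r x" "\<bar>q - x\<bar> < r x" using k subsetD[of k "ball x (r x)" l] subsetD[of k "ball x (r x)" q] by (auto simp: dist_real_def)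
        have 1: "norm (f l - f x - (l - x) *\<^sub>R f' x) \<le> c * (x - l)"
          using r(2)[of x l] lq k xk by auto
        have 2: "norm (f q - f x - (q - x) *\<^sub>R f' x) \<le> c * (q - x)"
          using r(2)[of x q] lq k xk by auto
        have "?F z = (f l - f x - (l - x) *\<^sub>R f' x) - (f q - f x - (q - x) *\<^sub>R f' x)"
          using k xk zx by (simp add: g_def algebra_simps)
        also have "norm \<dots> \<le> c * (x - l) + c * (q - x)"
          by (rule order_trans[OF norm_triangle_ineq4 add_mono[OF 1 2]])
        also have "\<dots> = c * measure lborel (snd z)" using k zx by (simp add: algebra_simps)
        finally show "norm (?F z) \<le> c * measure lborel (snd z)" .
      qed
      also have "\<dots> \<le> (\<Sum>z\<in>p. c * measure lborel (snd z))"
        by (rule sum_mono2) (use pD(1) c in auto)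
      also have "\<dots> = c * (b - a)"
        using additive_content_tagged_division[of p a b] p ab
        by (simp add: case_prod_unfold flip: sum_distrib_left)
      finally have A: "norm (\<Sum>z\<in>{z\<in>p. fst z \<notin> N}. ?F z) < e / 2" using cab by linarith
      define P where "P = {z\<in>p. fst z \<in> N \<and> measure lborel (snd z) \<noteq> 0}"
      have Pfin: "finite P" using pD(1) by (simp add: P_def)
      then obtain h where h: "bij_betw h {..<card P} P"
        using bij_betw_from_nat_into_finite by blast
      have hP: "h i \<in> P" if "i < card P" for i using h that by (auto simp: bij_betw_def)
      define l where "l i = Inf (snd (h i))" for i
      define q where "q i = Sup (snd (h i))" for i
      have lq: "snd (h i) = {l i..q i} \<and> a \<le> l i \<and> l i \<le> q i \<and> q i \<le> b \<and> l i < q i" if "i < card P" for i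
      proof -
        obtain x k where xk: "h i = (x,k)" by (cases "h i")
        then have "(x,k) \<in> p" "measure lborel k \<noteq> 0" using hP[OF that] by (auto simp: P_def)
        then show ?thesis using pk[of x k] xk by (auto simp: l_def q_def)
      qed
      have disj: "q i \<le> l j \<or> q j \<le> l i" if ij: "i < card P" "j < card P" "i \<noteq> j" for i j
      proof -
        have "h i \<noteq> h j" using h ij by (auto simp: bij_betw_def inj_on_def)
        moreover have "h i \<in> p" "h j \<in> p" using hP ij by (auto simp: P_def)
        ultimately have "interior (snd (h i)) \<inter> interior (snd (h j)) = {}"
          using pD(5)[of "fst (h i)" "snd (h i)" "fst (h j)" "snd (h j)"] by (simp add: prod_eq_iff)
        then have "{l i<..<q i} \<inter> {l j<..<q j} = {}"
          using lq ij by simp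
        then have "\<not> (max (l i) (l j) < min (q i) (q j))"
          using dense[of "max (l i) (l j)" "min (q i) (q j)"] by (auto simp: disjoint_iff)
        then show ?thesis using lq[OF ij(1)] lq[OF ij(2)] by linarith
      qed
      have "(\<Sum>i<card P. q i - l i) = (\<Sum>i<card P. measure lebesgue {l i..q i})"
        using lq by (intro sum.cong) auto
      also have "\<dots> = measure lebesgue (\<Union>i<card P. {l i..q i})"
      proof (rule measure_negligible_finite_Union_image[symmetric])
        show "pairwise (\<lambda>i j. negligible ({l i..q i} \<inter> {l j..q j})) {..<card P}"
        proof (intro pairwiseI)
          fix i j assume "i \<in> {..<card P}" "j \<in> {..<card P}" "i \<noteq> j"
          then have "{l i..q i} \<inter> {l j..q j} \<subseteq> {q i, q j}" using disj[of i j] by force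
          then show "negligible ({l i..q i} \<inter> {l j..q j})"
            by (meson finite.intros finite_subset negligible_finite)
        qed
      qed auto
      also have "\<dots> \<le> measure lebesgue U"
      proof (rule measure_mono_fmeasurable[OF _ _ Um])
        show "(\<Union>i<card P. {l i..q i}) \<subseteq> U"
        proof (safe)
          fix i x assume i: "i < card P" and x: "x \<in> {l i..q i}"
          have "h i \<in> p" "fst (h i) \<in> N" using hP[OF i] by (auto simp: P_def)
          then have "snd (h i) \<subseteq> U" using fineD[OF fine, of "fst (h i)" "snd (h i)"]
            by (simp add: G_def)
          then show "x \<in> U" using lq[OF i] x by auto
        qed
      qed auto
      finally have "(\<Sum>i<card P. q i - l i) < \<delta>" using Ud by linarith
      then have "(\<Sum>i<card P. dist (f (q i)) (f (l i))) < e / 2"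
        by (intro acd[of "card P" l q]) (use lq disj in auto)
      moreover have "norm (\<Sum>z\<in>P. ?F z) \<le> (\<Sum>z\<in>P. dist (f (Sup (snd z))) (f (Inf (snd z))))"
        by (rule sum_norm_le) (auto simp: P_def g_def dist_norm norm_minus_commute)
      moreover have "(\<Sum>z\<in>P. dist (f (Sup (snd z))) (f (Inf (snd z)))) = (\<Sum>i<card P. dist (f (q i)) (f (l i)))"
        unfolding q_def l_def by (rule sum.reindex_bij_betw[OF h, symmetric])
      ultimately have "norm (\<Sum>z\<in>P. ?F z) < e/2" by linarith
      with A have "norm (\<Sum>z\<in>{z\<in>p. fst z \<notin> N}. ?F z) + norm (\<Sum>z\<in>P. ?F z) < e" by linarith
      then show ?thesis unfolding eq P_def[symmetric]
        by (rule le_less_trans[OF norm_triangle_ineq])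
    qed
    ultimately
    show "\<exists>\<gamma>. gauge \<gamma> \<and> (\<forall>\<D>. \<D> tagged_division_of {a..b} \<and> \<gamma> fine \<D> \<longrightarrow>
        norm ((\<Sum>(x,k)\<in>\<D>. measure lborel k *\<^sub>R g x) - (f b - f a)) < e)"
      by (intro exI[of _ G]) simp
  qed
  then show ?thesis
    by (rule has_integral_spike[OF N, rotated]) (auto simp: g_def)
qed

section \<open>Finite-dimensional preliminaries\<close>

lemma quadratic_nonpos_imp_zero:
  fixes c d :: real
  assumes "\<And>t. 2 * t * c + t\<^sup>2 * d \<le> 0" and "c \<ge> 0"
  shows "c = 0"
proof (rule ccontr)
  assume "c \<noteq> 0"
  then have c: "c > 0" using assms(2) by simp
  define t where "t = c / (\<bar>d\<bar> + c)"
  have t: "t > 0" using c by (simp add: t_def add_nonneg_pos)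
  have "t * \<bar>d\<bar> \<le> c" using c by (simp add: t_def field_simps)
  then have "t * (t * \<bar>d\<bar>) \<le> t * c" using t by simp
  moreover have "- (t * (t * \<bar>d\<bar>)) \<le> t * (t * d)" using t
    by (metis abs_ge_minus_self minus_le_iff mult_le_cancel_left_pos mult_minus_right)
  moreover have "t * c > 0" using t c by simp
  ultimately show False using assms(1)[of t] by (simp add: power2_eq_square mult.assoc)
qed

text \<open>A maximizer of the Rayleigh quotient on the unit sphere of \<open>V\<close> is an
  eigenvector: since \<open>V\<close> is invariant, the residual
  \<open>S e - \<mu> *\<^sub>R e\<close> is itself an admissible direction of variation.\<close>

lemma selfadjoint_eigenvector:
  fixes S :: "'a::euclidean_space \<Rightarrow> 'a"
  assumes lin: "linear S" and sym: "\<And>x y. S x \<bullet> y = x \<bullet> S y"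
    and V: "subspace V" "S ` V \<subseteq> V" "V \<noteq> {0}"
  obtains e \<mu> where "e \<in> V" "norm e = 1" "S e = \<mu> *\<^sub>R e"
proof -
  define K where "K = sphere 0 1 \<inter> V"
  have "compact K" unfolding K_def
    by (intro compact_Int_closed compact_sphere closed_subspace V)
  obtain v where v: "v \<in> V" "v \<noteq> 0" using V subspace_0 by blast
  then have "(1 / norm v) *\<^sub>R v \<in> K"
    using V by (auto simp: K_def subspace_mul)
  then have "K \<noteq> {}" by blast
  have "continuous_on K (\<lambda>x. S x \<bullet> x)"
    using lin by (intro continuous_intros linear_continuous_on linear_conv_bounded_linear[THEN iffD1])
  then obtain e where e: "e \<in> K" and max: "\<And>x. x \<in> K \<Longrightarrow> S x \<bullet> x \<le> S e \<bullet> e"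
    using continuous_attains_sup[OF \<open>compact K\<close> \<open>K \<noteq> {}\<close>] by blast
  define \<mu> where "\<mu> = S e \<bullet> e"
  have eV: "e \<in> V" and ne: "norm e = 1" using e by (auto simp: K_def)
  have le: "S x \<bullet> x \<le> \<mu> * (x \<bullet> x)" if "x \<in> V" for x
  proof (cases "x = 0")
    case False
    then have "(1 / norm x) *\<^sub>R x \<in> K" using that V by (auto simp: K_def subspace_mul)
    from max[OF this] have "(S x \<bullet> x) / (norm x * norm x) \<le> \<mu>"
      using linear_scale[OF lin] by (simp add: \<mu>_def)
    then show ?thesis using False by (simp add: field_simps dot_square_norm power2_eq_square)
  qed (use linear_0[OF lin] in simp)
  define g where "g = S e - \<mu> *\<^sub>R e"
  have gV: "g \<in> V" unfolding g_def using V eV by (intro subspace_diff subspace_mul) auto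
  \<comment> \<open>First-order condition at the maximum: in the direction \<open>g\<close> the
    coefficient of \<open>2 * t\<close> is exactly \<open>g \<bullet> g\<close>.\<close>
  have "g \<bullet> g = 0"
  proof (rule quadratic_nonpos_imp_zero[of _ "S g \<bullet> g - \<mu> * (g \<bullet> g)"])
    fix t
    have "e + t *\<^sub>R g \<in> V" using V eV gV by (intro subspace_add subspace_mul)
    from le[OF this]
    have "S e \<bullet> e + 2 * t * (S e \<bullet> g) + t\<^sup>2 * (S g \<bullet> g) \<le> \<mu> * (e \<bullet> e + 2 * t * (e \<bullet> g) + t\<^sup>2 * (g \<bullet> g))"
      using sym[of g e] by (simp add: linear_add[OF lin] linear_scale[OF lin] inner_simps inner_commute power2_eq_square algebra_simps)
    moreover have "g \<bullet> g = S e \<bullet> g - \<mu> * (e \<bullet> g)"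
      unfolding g_def by (simp only: inner_diff_left inner_scaleR_left)
    then have "2 * t * (g \<bullet> g) = 2 * t * (S e \<bullet> g) - 2 * t * (\<mu> * (e \<bullet> g))"
      by (simp add: right_diff_distrib)
    moreover have "e \<bullet> e = 1" using ne by (simp add: dot_square_norm)
    moreover have "S e \<bullet> e = \<mu>" by (simp add: \<mu>_def)
    ultimately show "2 * t * (g \<bullet> g) + t\<^sup>2 * (S g \<bullet> g - \<mu> * (g \<bullet> g)) \<le> 0"
      by (simp add: algebra_simps)
  qed simp
  then have "S e = \<mu> *\<^sub>R e" by (simp add: g_def)
  with eV ne show thesis by (rule that)
qed

text \<open>Induction on the dimension: once an eigenvector \<open>e\<close> is found,
  \<open>S - \<mu>\<close> sends \<open>V\<close> into the orthogonal complement of \<open>e\<close>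
  in \<open>V\<close>. The number of factors is fixed in advance because it determines the order of
  the test functions used later.\<close>

lemma selfadjoint_annihilator_subspace:
  fixes S :: "'a::euclidean_space \<Rightarrow> 'a"
  assumes lin: "linear S" and sym: "\<And>x y. S x \<bullet> y = x \<bullet> S y"
    and K: "\<And>x. norm (S x) \<le> K * norm x" "K \<ge> 0"
    and V: "subspace V" "S ` V \<subseteq> V" "dim V \<le> n"
  shows "\<exists>\<mu>s. length \<mu>s = n \<and> (\<forall>\<mu>\<in>set \<mu>s. \<bar>\<mu>\<bar> \<le> K) \<and> (\<forall>x\<in>V. foldr (\<lambda>\<mu> y. S y - \<mu> *\<^sub>R y) \<mu>s x = 0)"
  using V
proof (induction n arbitrary: V)
  case 0
  then show ?case by (auto simp: dim_eq_0)
next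
  case (Suc n)
  have zero: "foldr (\<lambda>\<mu> y. S y - \<mu> *\<^sub>R y) \<mu>s 0 = 0" for \<mu>s
    by (induction \<mu>s) (auto simp: linear_0[OF lin])
  show ?case
  proof (cases "V = {0}")
    case True
    then show ?thesis
      \<comment> \<open>Zeros pad the list when the space is exhausted early.\<close>
      by (intro exI[of _ "replicate (Suc n) 0"]) (use K zero[of "replicate (Suc n) 0"] in auto)
  next
    case False
    obtain e \<mu> where e: "e \<in> V" "norm e = 1" "S e = \<mu> *\<^sub>R e"
      using selfadjoint_eigenvector[OF lin sym Suc.prems(1,2) False] by blast
    define W where "W = {x \<in> V. x \<bullet> e = 0}"
    have W: "subspace W" using Suc.prems(1)
      by (auto simp: W_def subspace_def inner_simps)
    have SW: "S ` W \<subseteq> W"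
      using Suc.prems(2) e(3) by (auto simp: W_def sym)
    have "e \<notin> W" using e by (auto simp: W_def dot_square_norm)
    then have "span W \<subset> span V"
      using e(1) W Suc.prems(1) by (auto simp: span_eq_iff[THEN iffD2] psubset_eq) (auto simp: W_def)
    then have "dim W < dim V" by (rule dim_psubset)
    then obtain \<mu>s where \<mu>s: "length \<mu>s = n" "\<forall>\<mu>\<in>set \<mu>s. \<bar>\<mu>\<bar> \<le> K"
      "\<And>x. x \<in> W \<Longrightarrow> foldr (\<lambda>\<mu> y. S y - \<mu> *\<^sub>R y) \<mu>s x = 0"
      using Suc.IH[OF W SW] Suc.prems(3) by fastforce
    have "\<bar>\<mu>\<bar> \<le> K" using K(1)[of e] e by simp
    moreover have "S x - \<mu> *\<^sub>R x \<in> W" if "x \<in> V" for x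
      using that Suc.prems(1,2) e(3) by (auto simp: W_def subspace_diff subspace_mul inner_simps sym image_subset_iff)
    ultimately show ?thesis
      \<comment> \<open>\<open>foldr\<close> applies the last factor first, so the new eigenvalue
        goes to the end of the list.\<close>
      using \<mu>s by (intro exI[of _ "\<mu>s @ [\<mu>]"]) auto
  qed
qed

lemma selfadjoint_annihilator:
  fixes S :: "'a::euclidean_space \<Rightarrow> 'a"
  assumes "linear S" and "\<And>x y. S x \<bullet> y = x \<bullet> S y"
    and "\<And>x. norm (S x) \<le> K * norm x" "K \<ge> 0"
  obtains \<mu>s where "length \<mu>s = DIM('a)" "\<forall>\<mu>\<in>set \<mu>s. \<bar>\<mu>\<bar> \<le> K"
    "\<And>x. foldr (\<lambda>\<mu> y. S y - \<mu> *\<^sub>R y) \<mu>s x = 0"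
  using selfadjoint_annihilator_subspace[OF assms, of UNIV "DIM('a)"] by (auto simp: dim_UNIV)

text \<open>A norm-preserving extension of a functional given by its graph. The bound at
  \<open>b = 0\<close> makes \<open>G\<close> single-valued over its first projection; a
  representing vector is then projected orthogonally onto that projection.\<close>

lemma bounded_graph_functional:
  fixes G :: "('b::euclidean_space \<times> real) set"
  assumes G: "subspace G" and C: "\<And>b a. (b, a) \<in> G \<Longrightarrow> \<bar>a\<bar> \<le> C * norm b" and "C \<ge> 0"
  obtains l where "norm l \<le> C" "\<And>b a. (b, a) \<in> G \<Longrightarrow> a = l \<bullet> b"
proof -
  have lf: "linear (fst :: 'b \<times> real \<Rightarrow> 'b)" by (simp add: linear_fst)
  have "inj_on fst (span G)"
  proof (rule inj_onI)
    fix p q assume pq: "p \<in> span G" "q \<in> span G" "fst p = fst q"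
    then have "p - q \<in> G" using G by (metis span_eq_iff subspace_diff)
    then have "(0, snd p - snd q) \<in> G" using pq(3) by (cases p; cases q) auto
    from C[OF this] show "p = q" using pq(3) by (simp add: prod_eq_iff)
  qed
  then obtain g where g: "linear g" "\<And>p. p \<in> G \<Longrightarrow> g (fst p) = p"
    using linear_inj_on_left_inverse[OF lf] span_base by metis
  define f where "f b = snd (g b)" for b
  have f: "linear f" unfolding f_def using linear_compose[OF g(1) linear_snd] by (simp add: o_def)
  define l0 where "l0 = (\<Sum>i\<in>Basis. f i *\<^sub>R i)"
  have fl: "f b = l0 \<bullet> b" for b
  proof -
    have "f b = f (\<Sum>i\<in>Basis. (b \<bullet> i) *\<^sub>R i)" by (simp add: euclidean_representation)
    also have "\<dots> = l0 \<bullet> b"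
      by (simp add: l0_def linear_sum[OF f] linear_scale[OF f] inner_sum_left inner_sum_right inner_commute mult.commute)
    finally show ?thesis .
  qed
  have T: "subspace (fst ` G)" using linear_subspace_image[OF lf G] .
  \<comment> \<open>The vector \<open>l0\<close> represents an arbitrary linear extension, which
    need not satisfy the bound. Its component \<open>l\<close> in the domain does, as testing the
    bound on \<open>l\<close> itself shows.\<close>
  obtain l z where l: "l \<in> span (fst ` G)" "\<And>w. w \<in> span (fst ` G) \<Longrightarrow> orthogonal z w" "l0 = l + z"
    using orthogonal_subspace_decomp_exists[of "fst ` G" l0] by metis
  have lT: "l \<in> fst ` G" using l(1) T by (simp add: span_eq_iff[THEN iffD2])
  have ip: "l0 \<bullet> b = l \<bullet> b" if "b \<in> fst ` G" for b
    using l(2)[of b] that l(3) by (simp add: span_base orthogonal_def inner_simps)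
  have fC: "\<bar>f b\<bar> \<le> C * norm b" if b: "b \<in> fst ` G" for b
  proof -
    obtain a where a: "(b,a) \<in> G" using b by force
    then have "f b = a" using g(2)[OF a] by (simp add: f_def)
    with C[OF a] show ?thesis by simp
  qed
  have "norm l * norm l \<le> C * norm l"
    using fC[OF lT] ip[OF lT] by (simp add: fl dot_square_norm power2_eq_square)
  then have "norm l \<le> C" using \<open>C \<ge> 0\<close> by (cases "l = 0") auto
  moreover have "a = l \<bullet> b" if "(b,a) \<in> G" for b a
  proof -
    have "b \<in> fst ` G" using that by force
    then show ?thesis using g(2)[OF that] ip fl by (simp add: f_def) (metis snd_conv)
  qed
  ultimately show thesis by (rule that)
qed

text \<open>Supplies the coefficients that make moments of a control vanish, while the normalization
  keeps the area and the speed of the resulting loop under control.\<close>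

lemma normalized_linear_dependence:
  fixes V :: "nat \<Rightarrow> 'a::euclidean_space"
  assumes n: "DIM('a) < n"
  obtains \<alpha> where "(\<Sum>l<n. (\<alpha> l)\<^sup>2) = 1" "(\<Sum>l<n. \<alpha> l *\<^sub>R V l) = 0"
proof -
  have "\<exists>\<beta>. (\<exists>l<n. \<beta> l \<noteq> 0) \<and> (\<Sum>l<n. \<beta> l *\<^sub>R V l) = 0"
  \<comment> \<open>Independence is a notion for sets, so a repetition among the vectors is a
    separate case.\<close>
  proof (cases "inj_on V {..<n}")
    case True
    then have "card (V ` {..<n}) = n" by (simp add: card_image)
    then have "dependent (V ` {..<n})" using independent_bound[of "V ` {..<n}"] n by auto
    then obtain u where u: "\<exists>v\<in>V ` {..<n}. u v \<noteq> 0" "(\<Sum>v\<in>V ` {..<n}. u v *\<^sub>R v) = 0"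
      by (auto simp: dependent_finite)
    then show ?thesis
      by (intro exI[of _ "u \<circ> V"]) (auto simp: sum.reindex[OF True] o_def)
  next
    case False
    then obtain i j where ij: "i < n" "j < n" "i \<noteq> j" "V i = V j" by (auto simp: inj_on_def)
    define \<beta> where "\<beta> l = (if l = i then 1 else if l = j then - 1 else (0::real))" for l
    have "(\<Sum>l<n. \<beta> l *\<^sub>R V l) = (\<Sum>l\<in>{i,j}. \<beta> l *\<^sub>R V l)"
      using ij by (intro sum.mono_neutral_right) (auto simp: \<beta>_def)
    also have "\<dots> = 0" using ij by (simp add: \<beta>_def)
    finally show ?thesis using ij by (intro exI[of _ \<beta>]) (auto simp: \<beta>_def)
  qed
  then obtain \<beta> where \<beta>: "\<exists>l<n. \<beta> l \<noteq> 0" "(\<Sum>l<n. \<beta> l *\<^sub>R V l) = 0" by blast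
  define s where "s = (\<Sum>l<n. (\<beta> l)\<^sup>2)"
  have s: "s > 0" unfolding s_def using \<beta>(1) by (auto intro!: sum_pos2)
  define \<alpha> where "\<alpha> l = \<beta> l / sqrt s" for l
  have "(\<Sum>l<n. (\<alpha> l)\<^sup>2) = 1"
    using s by (simp add: \<alpha>_def power_divide s_def flip: sum_divide_distrib)
  moreover have "(\<Sum>l<n. \<alpha> l *\<^sub>R V l) = (1 / sqrt s) *\<^sub>R (\<Sum>l<n. \<beta> l *\<^sub>R V l)"
    by (simp add: \<alpha>_def scaleR_sum_right)
  ultimately show thesis using \<beta>(2) by (intro that) auto
qed

lemma finite_family_convergent_subsequence:
  fixes f :: "nat \<Rightarrow> nat \<Rightarrow> 'a::heine_borel"
  assumes "\<And>i. i < N \<Longrightarrow> bounded (range (f i))"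
  shows "\<exists>r L. strict_mono (r :: nat \<Rightarrow> nat) \<and> (\<forall>i<N. (\<lambda>n. f i (r n)) \<longlonglongrightarrow> L i)"
  using assms
proof (induction N)
  case 0
  then show ?case by (auto intro: strict_mono_id)
next
  case (Suc N)
  then obtain r L where r: "strict_mono r" "\<forall>i<N. (\<lambda>n. f i (r n)) \<longlonglongrightarrow> L i" by (metis less_SucI)
  have "bounded (range (\<lambda>n. f N (r n)))"
    by (rule bounded_subset[OF Suc.prems[of N]]) auto
  then obtain l q where q: "strict_mono q" "((\<lambda>n. f N (r n)) \<circ> q) \<longlonglongrightarrow> l"
    using bounded_imp_convergent_subsequence by blast
  have "(\<lambda>n. f i (r (q n))) \<longlonglongrightarrow> L i" if "i < N" for i
    using LIMSEQ_subseq_LIMSEQ[OF r(2)[rule_format, OF that] q(1)] by (simp add: o_def)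
  then show ?case using q strict_mono_compose[OF r(1) q(1)]
    by (intro exI[of _ "\<lambda>n. r (q n)"] exI[of _ "L(N := l)"]) (auto simp: o_def less_Suc_eq)
qed

section \<open>Controls and their perturbations\<close>

text \<open>Boundedness makes all products of controls and test functions integrable. By
  \<open>horizontal_curve_approx_steers\<close> the restriction to such controls does not change the
  infimum.\<close>

definition unit_bdd :: "(real \<Rightarrow> 'a::euclidean_space) \<Rightarrow> bool" where
  "unit_bdd f \<longleftrightarrow> f \<in> borel_measurable (lebesgue_on {0..1}) \<and> bounded (f ` {0..1})"

lemma unit_bddE:
  assumes "unit_bdd f"
  obtains C where "C \<ge> 0" "\<And>t. t \<in> {0..1} \<Longrightarrow> norm (f t) \<le> C"
proof -
  obtain C where C: "\<forall>x\<in>f ` {0..1}. norm x \<le> C"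
    using assms unfolding unit_bdd_def bounded_iff by blast
  then have "norm (f 0) \<le> C" by simp
  then have "0 \<le> C" by (rule order_trans[OF norm_ge_zero])
  then show thesis by (rule that) (use C in blast)
qed

lemma unit_bdd_lebesgue_integrable:
  assumes "unit_bdd f" shows "integrable (lebesgue_on {0..1}) f"
proof -
  obtain C where C: "C \<ge> 0" "\<And>t. t \<in> {0..1} \<Longrightarrow> norm (f t) \<le> C"
    using unit_bddE[OF assms] by blast
  show ?thesis
  proof (rule measurable_bounded_by_integrable_imp_lebesgue_integrable)
    show "integrable (lebesgue_on {0..1::real}) (\<lambda>t. C)"
    proof (intro finite_measure.integrable_const finite_measure_lebesgue_on)
      show "{0..1::real} \<in> lmeasurable" using lmeasurable_cbox[of "0::real" 1] by simp
    qed
  qed (use C assms in \<open>auto simp: unit_bdd_def\<close>)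
qed

lemma unit_bdd_integrable: "unit_bdd f \<Longrightarrow> f integrable_on {0..1}"
  by (rule integrable_on_lebesgue_on[OF unit_bdd_lebesgue_integrable]) auto

lemma unit_bdd_continuous: "continuous_on {0..1} f \<Longrightarrow> unit_bdd f"
  unfolding unit_bdd_def
  by (intro conjI continuous_imp_measurable_on_sets_lebesgue compact_imp_bounded compact_continuous_image) auto

lemma unit_bdd_bilinear:
  assumes h: "bounded_bilinear h" and f: "unit_bdd f" and g: "unit_bdd g"
  shows "unit_bdd (\<lambda>t. h (f t) (g t))"
  unfolding unit_bdd_def
proof (rule conjI)
  have "continuous_on UNIV (\<lambda>x. h (fst x) (snd x))"
    by (intro bounded_bilinear.continuous_on[OF h] continuous_intros)
  then show "(\<lambda>t. h (f t) (g t)) \<in> borel_measurable (lebesgue_on {0..1})"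
    by (rule borel_measurable_continuous_Pair[OF f[unfolded unit_bdd_def, THEN conjunct1]
          g[unfolded unit_bdd_def, THEN conjunct1]])
  obtain K where K: "\<And>a b. norm (h a b) \<le> norm a * norm b * K" "K \<ge> 0"
    using bounded_bilinear.nonneg_bounded[OF h] by blast
  obtain C where C: "C \<ge> 0" "\<And>t. t \<in> {0..1} \<Longrightarrow> norm (f t) \<le> C"
    using unit_bddE[OF f] by blast
  obtain D where D: "D \<ge> 0" "\<And>t. t \<in> {0..1} \<Longrightarrow> norm (g t) \<le> D"
    using unit_bddE[OF g] by blast
  have "norm (h (f t) (g t)) \<le> C * D * K" if "t \<in> {0..1}" for t
  proof -
    have "norm (f t) * norm (g t) \<le> C * D"
      by (rule mult_mono[OF C(2)[OF that] D(2)[OF that] C(1) norm_ge_zero])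
    then show ?thesis by (rule order_trans[OF K(1) mult_right_mono[OF _ K(2)]])
  qed
  then show "bounded ((\<lambda>t. h (f t) (g t)) ` {0..1})"
    unfolding bounded_iff by blast
qed

lemmas unit_bdd_inner = unit_bdd_bilinear[OF bounded_bilinear_inner]
lemmas unit_bdd_scaleR = unit_bdd_bilinear[OF bounded_bilinear_scaleR]

lemma unit_bdd_add: "unit_bdd f \<Longrightarrow> unit_bdd g \<Longrightarrow> unit_bdd (\<lambda>t. f t + g t)"
  by (auto simp: unit_bdd_def intro: bounded_plus_comp)

definition energy :: "(real \<Rightarrow> 'a::euclidean_space) \<Rightarrow> real" where
  "energy u = integral {0..1} (\<lambda>t. u t \<bullet> u t)"

lemma energy_add:
  assumes u: "unit_bdd u" and v: "unit_bdd v"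
  shows "energy (\<lambda>t. u t + v t) = energy u + 2 * integral {0..1} (\<lambda>t. u t \<bullet> v t) + energy v"
proof -
  have "energy (\<lambda>t. u t + v t) = integral {0..1} (\<lambda>t. (u t \<bullet> u t + 2 * (u t \<bullet> v t)) + v t \<bullet> v t)"
    unfolding energy_def by (rule integral_cong) (simp add: inner_simps inner_commute)
  also have "\<dots> = energy u + 2 * integral {0..1} (\<lambda>t. u t \<bullet> v t) + energy v"
    using u v by (simp add: energy_def integral_add integrable_add unit_bdd_integrable unit_bdd_inner)
  finally show ?thesis .
qed

text \<open>Only finitely many exceptional times are allowed, so that adding a \<open>C\<^sup>1\<close> perturbation to a
  control yields a curve that is again differentiable almost everywhere, without an appeal to
  Lebesgue's differentiation theorem.\<close>

definition steers :: "(real ^ 'm \<Rightarrow> real ^ 'm \<Rightarrow> real ^ 'k) \<Rightarrow> (real \<Rightarrow> real ^ 'm) \<Rightarrow> ('m, 'k) cpt \<Rightarrow> bool" where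
  "steers B u p \<longleftrightarrow> unit_bdd u \<and> (\<exists>\<gamma> S. continuous_on {0..1} \<gamma> \<and> finite S \<and>
     (\<forall>t\<in>{0<..<1} - S. (\<gamma> has_vector_derivative (u t, B (fst (\<gamma> t)) (u t))) (at t)) \<and>
     \<gamma> 0 = p \<and> \<gamma> 1 = 0)"

locale step2_group =
  fixes B :: "real ^ 'm \<Rightarrow> real ^ 'm \<Rightarrow> real ^ 'k"
  assumes carnot: "step2_carnot B"
begin

lemma bounded_bilinear_B: "bounded_bilinear B"
  using carnot unfolding step2_carnot_def bilinear_conv_bounded_bilinear by (rule conjunct1)

sublocale B: bounded_bilinear B
  by (rule bounded_bilinear_B)

lemma skew: "B x y = - B y x"
  by (rule carnot[unfolded step2_carnot_def, THEN conjunct2, THEN conjunct1, THEN spec, THEN spec])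

lemma B_self [simp]: "B x x = 0"
proof -
  have "2 *\<^sub>R B x x = 0"
    unfolding scaleR_2 using skew[of x x] by (rule eq_neg_iff_add_eq_0[THEN iffD1])
  then show ?thesis by simp
qed

lemma B_span: "span (range (\<lambda>(x, y). B x y)) = UNIV"
  by (rule carnot[unfolded step2_carnot_def, THEN conjunct2, THEN conjunct2])

lemmas unit_bdd_B = unit_bdd_bilinear[OF bounded_bilinear_B]

text \<open>The horizontal part of the curve becomes \<open>x + y\<close>, and horizontality
  determines the vertical part up to a constant. That constant is fixed by the condition at time 1,
  so the whole displacement shows at the starting point; \<open>B (fst p) (y 0)\<close> is the part
  belonging to the group product with \<open>(y 0, 0)\<close>.\<close>

lemma steers_perturb:
  assumes st: "steers B u p"
    and y: "\<And>t. t \<in> {0..1} \<Longrightarrow> (y has_vector_derivative v t) (at t)" and v: "continuous_on {0..1} v" and y1: "y 1 = 0"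
  shows "steers B (\<lambda>t. u t + v t)
    (fst p + y 0, snd p + B (fst p) (y 0) - 2 *\<^sub>R integral {0..1} (\<lambda>t. B (y t) (u t)) - integral {0..1} (\<lambda>t. B (y t) (v t)))"
proof -
  from st have u: "unit_bdd u" by (simp add: steers_def)
  from st obtain \<gamma> S where \<gamma>: "continuous_on {0..1} \<gamma>" "\<gamma> 0 = p" "\<gamma> 1 = 0" and S: "finite S"
    and d: "\<And>t. t \<in> {0<..<1} - S \<Longrightarrow> (\<gamma> has_vector_derivative (u t, B (fst (\<gamma> t)) (u t))) (at t)"
    unfolding steers_def by blast
  define x where "x t = fst (\<gamma> t)" for t
  define z where "z t = snd (\<gamma> t)" for t
  have xc: "continuous_on {0..1} x" and zc: "continuous_on {0..1} z"
    unfolding x_def z_def by (intro continuous_intros \<gamma>)+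
  have xd: "(x has_vector_derivative u t) (at t)" and zd: "(z has_vector_derivative B (x t) (u t)) (at t)"
    if "t \<in> {0<..<1} - S" for t
    using bounded_linear.has_vector_derivative[OF bounded_linear_fst d[OF that]]
      bounded_linear.has_vector_derivative[OF bounded_linear_snd d[OF that]]
    by (auto simp: x_def[abs_def] z_def[abs_def])
  have yc: "continuous_on {0..1} y"
    by (rule continuous_on_vector_derivative[of _ _ v]) (rule has_vector_derivative_at_within[OF y])
  \<comment> \<open>Differentiating \<open>B (y t) (x t)\<close> produces
    \<open>B (v t) (x t)\<close>, which is minus \<open>B (x t) (v t)\<close>; the factor 2
    compensates for this sign.\<close>
  define w where "w t = 2 *\<^sub>R B (x t) (v t) + B (y t) (v t)" for t
  have wc: "continuous_on {0..1} w"
    unfolding w_def by (intro continuous_intros B.continuous_on xc v yc)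
  define I where "I t = integral {t..1} w" for t
  have Id: "(I has_vector_derivative - w t) (at t)" if "t \<in> {0<..<1}" for t
  proof -
    have "(I has_vector_derivative - w t) (at t within {0..1})"
      unfolding I_def by (rule integral_has_vector_derivative'[OF wc]) (use that in auto)
    then show ?thesis using that by (simp add: at_within_Icc_at)
  qed
  have Ic: "continuous_on {0..1} I"
    unfolding I_def by (rule indefinite_integral_continuous_1'[OF integrable_continuous_real[OF wc]])
  \<comment> \<open>The integral of \<open>B y u\<close> has been integrated by parts, so that only continuous functions are integrated.\<close>
  define \<gamma>' where "\<gamma>' t = (x t + y t, z t + B (y t) (x t) - I t)" for t
  have "continuous_on {0..1} \<gamma>'"
    unfolding \<gamma>'_def by (intro continuous_intros B.continuous_on xc zc yc Ic)
  moreover have "(\<gamma>' has_vector_derivative (u t + v t, B (fst (\<gamma>' t)) (u t + v t))) (at t)" if t: "t \<in> {0<..<1} - S" for t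
  proof -
    have "(\<gamma>' has_vector_derivative (u t + v t, B (x t) (u t) + (B (y t) (u t) + B (v t) (x t)) - (- w t))) (at t)"
      unfolding \<gamma>'_def[abs_def] using t
      by (intro has_vector_derivative_Pair has_vector_derivative_add has_vector_derivative_diff
        bounded_bilinear.has_vector_derivative[OF bounded_bilinear_B] xd zd y Id) auto
    moreover have "B (x t) (u t) + (B (y t) (u t) + B (v t) (x t)) - (- w t) = B (x t + y t) (u t + v t)"
      using skew[of "v t" "x t"] by (simp add: w_def B.add_left B.add_right scaleR_2)
    ultimately show ?thesis by (simp add: \<gamma>'_def)
  qed
  moreover have "\<gamma>' 1 = 0"
    using \<gamma> y1 by (simp add: \<gamma>'_def I_def x_def z_def B.zero_left zero_prod_def)
  moreover have "\<gamma>' 0 = (fst p + y 0, snd p + B (fst p) (y 0) - 2 *\<^sub>R integral {0..1} (\<lambda>t. B (y t) (u t)) - integral {0..1} (\<lambda>t. B (y t) (v t)))"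
  proof -
    have ints: "(\<lambda>t. B (x t) (v t)) integrable_on {0..1}" "(\<lambda>t. B (y t) (v t)) integrable_on {0..1}"
      by (intro integrable_continuous_real B.continuous_on xc v yc)+
    have int3: "(\<lambda>t. B (y t) (u t)) integrable_on {0..1}"
      by (intro unit_bdd_integrable unit_bdd_B unit_bdd_continuous[OF yc] u)
    \<comment> \<open>The product rule for \<open>B (x t) (y t)\<close> eliminates \<open>x\<close>,
      so that the displacement depends on the original curve only through \<open>u\<close> and the
      starting point.\<close>
    have "((\<lambda>t. B (x t) (v t) + B (u t) (y t)) has_integral (B (x 1) (y 1) - B (x 0) (y 0))) {0..1}"
    proof (rule fundamental_theorem_of_calculus_interior_strong[OF S])
      fix t assume t: "t \<in> {0<..<1} - S"
      show "((\<lambda>t. B (x t) (y t)) has_vector_derivative B (x t) (v t) + B (u t) (y t)) (at t)"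
        by (rule bounded_bilinear.has_vector_derivative[OF bounded_bilinear_B xd[OF t] y]) (use t in auto)
    qed (auto intro!: B.continuous_on xc yc)
    then have "integral {0..1} (\<lambda>t. B (x t) (v t) + B (u t) (y t)) = - B (x 0) (y 0)"
      using y1 by (simp add: integral_unique B.zero_right)
    moreover have "(\<lambda>t. B (x t) (v t) + B (u t) (y t)) = (\<lambda>t. B (x t) (v t) - B (y t) (u t))"
    proof
      show "B (x t) (v t) + B (u t) (y t) = B (x t) (v t) - B (y t) (u t)" for t
        using skew[of "u t" "y t"] by simp
    qed
    ultimately have xv: "integral {0..1} (\<lambda>t. B (x t) (v t)) = integral {0..1} (\<lambda>t. B (y t) (u t)) - B (x 0) (y 0)"
      using ints int3 by (simp add: integral_diff algebra_simps)
    have "I 0 = 2 *\<^sub>R integral {0..1} (\<lambda>t. B (x t) (v t)) + integral {0..1} (\<lambda>t. B (y t) (v t))"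
      unfolding I_def w_def using ints by (subst integral_add) (auto intro!: integrable_cmul)
    then show ?thesis
      using \<gamma>(2) skew[of "y 0" "x 0"] unfolding xv by (simp add: \<gamma>'_def x_def z_def scaleR_2 algebra_simps)
  qed
  ultimately show ?thesis
    unfolding steers_def using S
    by (intro conjI exI[of _ \<gamma>'] exI[of _ S] unit_bdd_add[OF u unit_bdd_continuous[OF v]]) auto
qed

end

section \<open>Vertical displacements\<close>

lemma has_integral_cos_int:
  fixes j :: int
  assumes "j \<noteq> 0"
  shows "((\<lambda>t. cos (2 * pi * of_int j * t)) has_integral 0) {0..1}"
proof -
  have "((\<lambda>t. cos (2 * pi * of_int j * t)) has_integral
      (sin (2 * pi * of_int j * 1) / (2 * pi * of_int j) - sin (2 * pi * of_int j * 0) / (2 * pi * of_int j))) {0..1}"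
    using assms
    by (intro fundamental_theorem_of_calculus)
      (auto intro!: derivative_eq_intros simp flip: has_real_derivative_iff_has_vector_derivative)
  moreover have "sin (2 * pi * of_int j) = 0"
    using sin_integer_2pi[of "of_int j"] by (simp add: mult.assoc)
  ultimately show ?thesis by simp
qed

text \<open>Orthogonality diagonalizes the signed area as a quadratic form in the Fourier
  coefficients, which keeps it away from 0 on the unit sphere of coefficients.\<close>

lemma has_integral_sin_sin:
  fixes k l :: nat
  shows "((\<lambda>t. sin (2 * pi * real (Suc l) * t) * sin (2 * pi * real (Suc k) * t)) has_integral (if l = k then 1 / 2 else 0)) {0..1}"
proof -
  have eq: "sin (2 * pi * real (Suc l) * t) * sin (2 * pi * real (Suc k) * t)
    = (cos (2 * pi * of_int (int l - int k) * t) - cos (2 * pi * of_int (int l + int k + 2) * t)) / 2" for t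
  proof -
    have "2 * pi * real (Suc l) * t - 2 * pi * real (Suc k) * t = 2 * pi * of_int (int l - int k) * t"
      "2 * pi * real (Suc l) * t + 2 * pi * real (Suc k) * t = 2 * pi * of_int (int l + int k + 2) * t"
      by (simp_all add: algebra_simps)
    then show ?thesis by (simp only: sin_times_sin)
  qed
  have 1: "((\<lambda>t. cos (2 * pi * of_int (int l - int k) * t)) has_integral (if l = k then 1 else 0)) {0..1}"
  proof (cases "l = k")
    case True
    then show ?thesis using has_integral_const_real[of "1::real" 0 1] by simp
  next
    case False
    then show ?thesis using has_integral_cos_int[of "int l - int k"] by auto
  qed
  have "((\<lambda>t. (cos (2 * pi * of_int (int l - int k) * t) - cos (2 * pi * of_int (int l + int k + 2) * t)) / 2)
      has_integral ((if l = k then 1 else 0) - 0) / 2) {0..1}"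
    by (intro has_integral_divide has_integral_diff 1 has_integral_cos_int) auto
  then show ?thesis unfolding eq by (auto split: if_splits)
qed

context step2_group
begin

text \<open>A bound for the derivatives of trigonometric sums with \<open>2 * CARD('m) + 1\<close>
  frequencies and coefficients of absolute value at most 1.\<close>

definition vconst :: real where
  "vconst = (\<Sum>l<2 * CARD('m) + 1. 2 * pi * real (Suc l))"

text \<open>The loop lies in the span of \<open>e\<close> and \<open>f\<close> and uses the same
  coefficients \<alpha> for the sines and the cosines. Its area integral is then \<open>- k\<close>
  times the square of its scale, with \<open>k\<close> positive, so a scale of order
  \<open>sqrt s\<close> gives the required displacement at an energy cost of order
  \<open>s\<close>.\<close>

lemma steers_shift_bracket:
  assumes st: "steers B u p" and s: "s \<ge> 0"
  shows "\<exists>u'. steers B u' (fst p, snd p + s *\<^sub>R B e f) \<and>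
    energy u' \<le> energy u + s * (vconst * (norm e + norm f))\<^sup>2"
proof -
  have u: "unit_bdd u" using st by (simp add: steers_def)
  \<comment> \<open>One frequency more than the number of scalar conditions expressing that
    \<open>a\<close> and \<open>b\<close> have zero moment against \<open>u\<close>.\<close>
  define n where "n = 2 * CARD('m) + 1"
  define sn where "sn l t = sin (2 * pi * real (Suc l) * t)" for l :: nat and t :: real
  define cs where "cs l t = cos (2 * pi * real (Suc l) * t)" for l :: nat and t :: real
  have snc: "continuous_on {0..1} (sn l)" and csc: "continuous_on {0..1} (\<lambda>t. cs l t - 1)" for l
    unfolding sn_def cs_def by (intro continuous_intros)+
  have snd: "(sn l has_real_derivative 2 * pi * real (Suc l) * cs l t) (at t)" for l t
    unfolding sn_def[abs_def] cs_def by (auto intro!: derivative_eq_intros)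
  have csd: "((\<lambda>t. cs l t - 1) has_real_derivative - (2 * pi * real (Suc l) * sn l t)) (at t)" for l t
    unfolding sn_def cs_def by (auto intro!: derivative_eq_intros)
  let ?V = "\<lambda>l. (integral {0..1} (\<lambda>t. sn l t *\<^sub>R u t), integral {0..1} (\<lambda>t. (cs l t - 1) *\<^sub>R u t))"
  have "DIM((real^'m) \<times> (real^'m)) < n" by (simp add: n_def)
  then obtain \<alpha> where \<alpha>1: "(\<Sum>l<n. (\<alpha> l)\<^sup>2) = 1" and \<alpha>0: "(\<Sum>l<n. \<alpha> l *\<^sub>R ?V l) = 0"
    using normalized_linear_dependence[of n ?V] by blast
  have \<alpha>le: "\<bar>\<alpha> l\<bar> \<le> 1" if "l < n" for l
  proof -
    have "(\<alpha> l)\<^sup>2 \<le> (\<Sum>l<n. (\<alpha> l)\<^sup>2)" using that by (intro member_le_sum) auto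
    then show ?thesis using \<alpha>1 by (simp add: abs_square_le_1)
  qed
  define a where "a t = (\<Sum>l<n. \<alpha> l * sn l t)" for t
  \<comment> \<open>Subtracting 1 makes the loop start and end at the origin and leaves its
    derivative unchanged.\<close>
  define b where "b t = (\<Sum>l<n. \<alpha> l * (cs l t - 1))" for t
  define a' where "a' t = (\<Sum>l<n. \<alpha> l * (2 * pi * real (Suc l) * cs l t))" for t
  define b' where "b' t = (\<Sum>l<n. \<alpha> l * (- (2 * pi * real (Suc l) * sn l t)))" for t
  have ad: "(a has_real_derivative a' t) (at t)" for t
    unfolding a_def[abs_def] a'_def by (intro DERIV_sum DERIV_cmult snd)
  have bd: "(b has_real_derivative b' t) (at t)" for t
    unfolding b_def[abs_def] b'_def by (intro DERIV_sum DERIV_cmult csd)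
  have cont: "continuous_on {0..1} a" "continuous_on {0..1} b" "continuous_on {0..1} a'" "continuous_on {0..1} b'"
    unfolding a_def a'_def b_def b'_def sn_def cs_def by (intro continuous_intros)+
  have int_su: "(\<lambda>t. sn l t *\<^sub>R u t) integrable_on {0..1}" "(\<lambda>t. (cs l t - 1) *\<^sub>R u t) integrable_on {0..1}" for l
    by (intro unit_bdd_integrable unit_bdd_scaleR unit_bdd_continuous[OF snc] unit_bdd_continuous[OF csc] u)+
  have "integral {0..1} (\<lambda>t. a t *\<^sub>R u t) = (\<Sum>l<n. \<alpha> l *\<^sub>R integral {0..1} (\<lambda>t. sn l t *\<^sub>R u t))"
    using int_su(1) by (simp add: a_def scaleR_sum_left integral_sum integrable_cmul flip: scaleR_scaleR)
  also have "\<dots> = fst (\<Sum>l<n. \<alpha> l *\<^sub>R ?V l)" by (simp add: fst_sum)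
  finally have au: "integral {0..1} (\<lambda>t. a t *\<^sub>R u t) = 0" unfolding \<alpha>0 by simp
  have "integral {0..1} (\<lambda>t. b t *\<^sub>R u t) = (\<Sum>l<n. \<alpha> l *\<^sub>R integral {0..1} (\<lambda>t. (cs l t - 1) *\<^sub>R u t))"
    using int_su(2) by (simp add: b_def scaleR_sum_left integral_sum integrable_cmul flip: scaleR_scaleR)
  also have "\<dots> = snd (\<Sum>l<n. \<alpha> l *\<^sub>R ?V l)" by (simp add: snd_sum)
  finally have bu: "integral {0..1} (\<lambda>t. b t *\<^sub>R u t) = 0" unfolding \<alpha>0 by simp
  \<comment> \<open>Minus the integral of \<open>a * b' - b * a'\<close>; the normalization of
    \<alpha> bounds it below by the lowest frequency.\<close>
  define k where "k = 2 * pi * (\<Sum>l<n. (\<alpha> l)\<^sup>2 * real (Suc l))"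
  have "(\<Sum>l<n. (\<alpha> l)\<^sup>2 * 1) \<le> (\<Sum>l<n. (\<alpha> l)\<^sup>2 * real (Suc l))"
    by (intro sum_mono mult_left_mono) auto
  then have "2 * pi * 1 \<le> k" unfolding k_def using \<alpha>1 by (intro mult_left_mono) auto
  then have k: "k \<ge> 1" using pi_ge_two by simp
  have ab': "((\<lambda>t. a t * b' t) has_integral - k / 2) {0..1}"
  proof -
    have "((\<lambda>t. \<Sum>l<n. \<Sum>j<n. (- (\<alpha> l * \<alpha> j * (2 * pi * real (Suc j)))) * (sn l t * sn j t)) has_integral
       (\<Sum>l<n. \<Sum>j<n. (- (\<alpha> l * \<alpha> j * (2 * pi * real (Suc j)))) * (if l = j then 1 / 2 else 0))) {0..1}"
      unfolding sn_def by (intro has_integral_sum has_integral_mult_right has_integral_sin_sin) auto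
    moreover have "(\<Sum>l<n. \<Sum>j<n. (- (\<alpha> l * \<alpha> j * (2 * pi * real (Suc j)))) * (sn l t * sn j t)) = a t * b' t" for t
      unfolding a_def b'_def sum_product by (intro sum.cong refl) (simp add: algebra_simps)
    moreover have "(\<Sum>l<n. \<Sum>j<n. (- (\<alpha> l * \<alpha> j * (2 * pi * real (Suc j)))) * (if l = j then 1 / 2 else 0)) = - k / 2"
      by (simp add: k_def sum_distrib_left power2_eq_square sum_negf if_distrib sum.delta sum_divide_distrib mult_ac cong: if_cong)
    ultimately show ?thesis by simp
  qed
  have ab0: "a 0 = 0" "a 1 = 0" "b 0 = 0" "b 1 = 0"
    unfolding a_def b_def sn_def cs_def
    using sin_integer_2pi[of "real (Suc l)" for l] cos_integer_2pi[of "real (Suc l)" for l]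
    by (simp_all add: mult.assoc del: of_nat_Suc)
  \<comment> \<open>As \<open>a * b\<close> vanishes at both ends, the two halves of the area
    integral are opposite.\<close>
  have "((\<lambda>t. a t * b' t + a' t * b t) has_integral (a 1 * b 1 - a 0 * b 0)) {0..1}"
    by (rule fundamental_theorem_of_calculus)
      (auto intro!: DERIV_mult'[THEN DERIV_subset] ad bd simp flip: has_real_derivative_iff_has_vector_derivative)
  then have ba': "((\<lambda>t. a' t * b t) has_integral k / 2) {0..1}"
    using has_integral_diff[OF _ ab'] ab0 by fastforce
  have om: "((\<lambda>t. a t * b' t - b t * a' t) has_integral - k) {0..1}"
    using has_integral_diff[OF ab' ba'] by (simp add: mult.commute)
  define w where "w t = a' t *\<^sub>R e + b' t *\<^sub>R f" for t
  have wc: "continuous_on {0..1} w" unfolding w_def by (intro continuous_intros cont)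
  define J where "J = integral {0..1} (\<lambda>t. u t \<bullet> w t)"
  \<comment> \<open>The endpoint depends only on \<open>r\<^sup>2\<close>, so the sign of \<open>r\<close> is free to make the linear energy term nonpositive.\<close>
  define r where "r = (if J \<le> 0 then sqrt (s / k) else - sqrt (s / k))"
  have r2: "r\<^sup>2 = s / k" using s k by (simp add: r_def)
  have rJ: "r * J \<le> 0"
    using s k by (auto simp: r_def mult_nonneg_nonpos mult_nonneg_nonneg)
  define y where "y t = r *\<^sub>R (a t *\<^sub>R e + b t *\<^sub>R f)" for t
  define v where "v t = r *\<^sub>R w t" for t
  have yd: "(y has_vector_derivative v t) (at t)" for t
    unfolding y_def[abs_def] v_def w_def
    by (rule derivative_eq_intros ad bd refl | simp)+
  have vc: "continuous_on {0..1} v" unfolding v_def by (intro continuous_intros wc)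
  have y01: "y 0 = 0" "y 1 = 0" by (simp_all add: y_def ab0)
  have iau: "(\<lambda>t. a t *\<^sub>R u t) integrable_on {0..1}" and ibu: "(\<lambda>t. b t *\<^sub>R u t) integrable_on {0..1}"
    by (intro unit_bdd_integrable unit_bdd_scaleR cont[THEN unit_bdd_continuous] u)+
  have "((\<lambda>t. B e (a t *\<^sub>R u t)) has_integral B e 0) {0..1}"
    using has_integral_linear[OF integrable_integral[OF iau] B.bounded_linear_right[of e]] au by (simp add: o_def)
  moreover have "((\<lambda>t. B f (b t *\<^sub>R u t)) has_integral B f 0) {0..1}"
    using has_integral_linear[OF integrable_integral[OF ibu] B.bounded_linear_right[of f]] bu by (simp add: o_def)
  ultimately have "((\<lambda>t. r *\<^sub>R (B e (a t *\<^sub>R u t) + B f (b t *\<^sub>R u t))) has_integral r *\<^sub>R (B e 0 + B f 0)) {0..1}"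
    by (intro has_integral_cmul has_integral_add)
  moreover have "r *\<^sub>R (B e (a t *\<^sub>R u t) + B f (b t *\<^sub>R u t)) = B (y t) (u t)" for t
    by (simp add: y_def B.add_left B.scaleR_left B.scaleR_right)
  ultimately have yu: "integral {0..1} (\<lambda>t. B (y t) (u t)) = 0"
    by (simp add: integral_unique B.zero_right)
  have "((\<lambda>t. (a t * b' t - b t * a' t) *\<^sub>R (r\<^sup>2 *\<^sub>R B e f)) has_integral (- k) *\<^sub>R (r\<^sup>2 *\<^sub>R B e f)) {0..1}"
    by (rule has_integral_scaleR_left[OF om])
  moreover have "(a t * b' t - b t * a' t) *\<^sub>R (r\<^sup>2 *\<^sub>R B e f) = B (y t) (v t)" for t
    using skew[of f e] by (simp add: y_def v_def w_def B.add_left B.add_right B.scaleR_left B.scaleR_right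
        power2_eq_square scaleR_left_diff_distrib right_diff_distrib scaleR_add_right mult_ac)
  ultimately have yv: "integral {0..1} (\<lambda>t. B (y t) (v t)) = - (s *\<^sub>R B e f)"
    using r2 k by (simp add: integral_unique)
  have "steers B (\<lambda>t. u t + v t) (fst p, snd p + s *\<^sub>R B e f)"
    using steers_perturb[OF st yd vc y01(2)] by (simp add: y01 yu yv B.zero_right)
  moreover have "energy (\<lambda>t. u t + v t) \<le> energy u + s * (vconst * (norm e + norm f))\<^sup>2"
  proof -
    have "integral {0..1} (\<lambda>t. u t \<bullet> v t) = r * J"
      by (simp add: v_def J_def)
    moreover have "energy v \<le> s * (vconst * (norm e + norm f))\<^sup>2"
    proof -
      have vn: "v t \<bullet> v t \<le> s * (vconst * (norm e + norm f))\<^sup>2" for t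
      proof -
        have "\<bar>a' t\<bar> \<le> (\<Sum>l<n. 1 * (2 * pi * real (Suc l) * 1))"
          unfolding a'_def
          by (intro sum_abs[THEN order_trans] sum_mono) (auto simp: abs_mult cs_def intro!: mult_le_one \<alpha>le)
        then have a'b: "\<bar>a' t\<bar> \<le> vconst" by (simp add: vconst_def n_def)
        have "\<bar>b' t\<bar> \<le> (\<Sum>l<n. 1 * (2 * pi * real (Suc l) * 1))"
          unfolding b'_def
          by (intro sum_abs[THEN order_trans] sum_mono) (auto simp: abs_mult sn_def intro!: mult_le_one \<alpha>le)
        then have b'b: "\<bar>b' t\<bar> \<le> vconst" by (simp add: vconst_def n_def)
        have "norm (w t) \<le> \<bar>a' t\<bar> * norm e + \<bar>b' t\<bar> * norm f"
          unfolding w_def by (rule norm_triangle_le) simp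
        also have "\<dots> \<le> vconst * norm e + vconst * norm f"
          by (intro add_mono mult_right_mono a'b b'b) auto
        finally have "norm (w t) \<le> vconst * (norm e + norm f)" by (simp add: algebra_simps)
        then have "(norm (w t))\<^sup>2 \<le> (vconst * (norm e + norm f))\<^sup>2" by (intro power_mono) auto
        moreover have "s / k \<le> s" using s k mult_left_mono[of 1 k s] by (simp add: divide_le_eq)
        ultimately have "(s / k) * (norm (w t))\<^sup>2 \<le> s * (vconst * (norm e + norm f))\<^sup>2"
          using s by (intro mult_mono) auto
        moreover have "v t \<bullet> v t = r\<^sup>2 * (norm (w t))\<^sup>2"
          by (simp add: v_def dot_square_norm power2_eq_square)
        ultimately show ?thesis by (simp add: r2)
      qed
      have "energy v \<le> integral {0..1::real} (\<lambda>t. s * (vconst * (norm e + norm f))\<^sup>2)"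
        unfolding energy_def using vc vn
        by (intro integral_le integrable_continuous_real continuous_intros) auto
      then show ?thesis by simp
    qed
    ultimately show ?thesis
      using energy_add[OF u unit_bdd_continuous[OF vc]] rJ by linarith
  qed
  ultimately show ?thesis by blast
qed

text \<open>Uniformity in the control and in the starting point allows displacements to be performed
  one after the other, which is what makes these directions a subspace.\<close>

definition vertically_lipschitz :: "real ^ 'k \<Rightarrow> bool" where
  "vertically_lipschitz w \<longleftrightarrow> (\<exists>C\<ge>0. \<forall>u p s. steers B u p \<longrightarrow>
     (\<exists>u'. steers B u' (fst p, snd p + s *\<^sub>R w) \<and> energy u' \<le> energy u + C * \<bar>s\<bar>))"

text \<open>Negative multiples are reached by exchanging \<open>e\<close> and
  \<open>f\<close>.\<close>

lemma vertically_lipschitz_bracket: "vertically_lipschitz (B e f)"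
  unfolding vertically_lipschitz_def
proof (intro exI[of _ "(vconst * (norm e + norm f))\<^sup>2"] conjI allI impI)
  fix u p s assume st: "steers B u p"
  show "\<exists>u'. steers B u' (fst p, snd p + s *\<^sub>R B e f) \<and> energy u' \<le> energy u + (vconst * (norm e + norm f))\<^sup>2 * \<bar>s\<bar>"
  proof (cases "s \<ge> 0")
    case True
    then show ?thesis using steers_shift_bracket[OF st True, of e f] by (simp add: mult.commute)
  next
    case False
    moreover have "(- s) *\<^sub>R B f e = s *\<^sub>R B e f" using skew[of e f] by simp
    ultimately show ?thesis using steers_shift_bracket[OF st, of "- s" f e] by (simp add: mult.commute add.commute)
  qed
qed simp

text \<open>Here the assumption that brackets span the second layer enters: a subspace containing
  all brackets is everything.\<close>

lemma vertically_lipschitz_all: "vertically_lipschitz w"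
proof -
  have "subspace {w. vertically_lipschitz w}"
    unfolding subspace_def
  proof (intro conjI ballI allI; unfold mem_Collect_eq)
    show "vertically_lipschitz 0"
      unfolding vertically_lipschitz_def by (intro exI[of _ 0]) auto
  next
    fix v w assume "vertically_lipschitz v" "vertically_lipschitz w"
    then obtain C D where C: "C \<ge> 0" "\<And>u p s. steers B u p \<Longrightarrow>
       \<exists>u'. steers B u' (fst p, snd p + s *\<^sub>R v) \<and> energy u' \<le> energy u + C * \<bar>s\<bar>"
      and D: "D \<ge> 0" "\<And>u p s. steers B u p \<Longrightarrow>
       \<exists>u'. steers B u' (fst p, snd p + s *\<^sub>R w) \<and> energy u' \<le> energy u + D * \<bar>s\<bar>"
      unfolding vertically_lipschitz_def by blast
    show "vertically_lipschitz (v + w)"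
      unfolding vertically_lipschitz_def
    proof (intro exI[of _ "C + D"] conjI allI impI)
      fix u p s assume st: "steers B u p"
      obtain u1 where u1: "steers B u1 (fst p, snd p + s *\<^sub>R v)" "energy u1 \<le> energy u + C * \<bar>s\<bar>"
        using C(2)[OF st] by blast
      obtain u2 where u2: "steers B u2 (fst p, snd p + s *\<^sub>R v + s *\<^sub>R w)" "energy u2 \<le> energy u1 + D * \<bar>s\<bar>"
        using D(2)[OF u1(1), of s] by auto
      show "\<exists>u'. steers B u' (fst p, snd p + s *\<^sub>R (v + w)) \<and> energy u' \<le> energy u + (C + D) * \<bar>s\<bar>"
        using u1 u2 by (intro exI[of _ u2]) (simp add: algebra_simps)
    qed (use C D in simp)
  next
    fix c w assume "vertically_lipschitz w"
    then obtain D where D: "D \<ge> 0" "\<And>u p s. steers B u p \<Longrightarrow>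
       \<exists>u'. steers B u' (fst p, snd p + s *\<^sub>R w) \<and> energy u' \<le> energy u + D * \<bar>s\<bar>"
      unfolding vertically_lipschitz_def by blast
    show "vertically_lipschitz (c *\<^sub>R w)"
      unfolding vertically_lipschitz_def
    proof (intro exI[of _ "D * \<bar>c\<bar>"] conjI allI impI)
      fix u p s assume st: "steers B u p"
      show "\<exists>u'. steers B u' (fst p, snd p + s *\<^sub>R (c *\<^sub>R w)) \<and> energy u' \<le> energy u + D * \<bar>c\<bar> * \<bar>s\<bar>"
        using D(2)[OF st, of "s * c"] by (simp add: abs_mult mult_ac)
    qed (use D in simp)
  qed
  moreover have "range (\<lambda>(x, y). B x y) \<subseteq> {w. vertically_lipschitz w}"
    using vertically_lipschitz_bracket by auto
  ultimately have "span (range (\<lambda>(x, y). B x y)) \<subseteq> {w. vertically_lipschitz w}"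
    by (intro span_minimal)
  then show ?thesis unfolding B_span by auto
qed

text \<open>The coordinates of \<open>z\<close> are displaced one after the other, and the finitely
  many constants add up to one that serves every direction.\<close>

lemma steers_shift_vertical:
  obtains C where "C \<ge> 0"
    "\<And>u p z. steers B u p \<Longrightarrow> \<exists>u'. steers B u' (fst p, snd p + z) \<and> energy u' \<le> energy u + C * norm z"
proof -
  obtain C where C: "\<And>i. C i \<ge> 0" "\<And>i u p s. steers B u p \<Longrightarrow>
       \<exists>u'. steers B u' (fst p, snd p + s *\<^sub>R i) \<and> energy u' \<le> energy u + C i * \<bar>s\<bar>"
    using vertically_lipschitz_all unfolding vertically_lipschitz_def by metis
  have *: "\<exists>u'. steers B u' (fst p, snd p + (\<Sum>i\<in>A. (z \<bullet> i) *\<^sub>R i)) \<and> energy u' \<le> energy u + (\<Sum>i\<in>A. C i) * norm z"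
    if "finite A" "A \<subseteq> Basis" "steers B u p" for A u p z
    using that(1,2)
  proof (induction A rule: finite_induct)
    case empty
    then show ?case using that(3) by (intro exI[of _ u]) auto
  next
    case (insert i A)
    then obtain u1 where u1: "steers B u1 (fst p, snd p + (\<Sum>i\<in>A. (z \<bullet> i) *\<^sub>R i))" "energy u1 \<le> energy u + (\<Sum>i\<in>A. C i) * norm z"
      by auto
    obtain u2 where u2: "steers B u2 (fst p, snd p + (\<Sum>i\<in>A. (z \<bullet> i) *\<^sub>R i) + (z \<bullet> i) *\<^sub>R i)" "energy u2 \<le> energy u1 + C i * \<bar>z \<bullet> i\<bar>"
      using C(2)[OF u1(1), of "z \<bullet> i" i] by auto
    have "C i * \<bar>z \<bullet> i\<bar> \<le> C i * norm z"
      using insert.prems C(1) Basis_le_norm by (intro mult_left_mono) auto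
    then show ?case using u1 u2 insert.hyps
      by (intro exI[of _ u2]) (simp add: algebra_simps)
  qed
  show thesis
  proof (rule that[of "\<Sum>i\<in>Basis. C i"])
    fix u p z assume "steers B u p"
    from *[OF finite_Basis order_refl this, of z]
    show "\<exists>u'. steers B u' (fst p, snd p + z) \<and> energy u' \<le> energy u + (\<Sum>i\<in>Basis. C i) * norm z"
      by (simp add: euclidean_representation)
  qed (use C in \<open>simp add: sum_nonneg\<close>)
qed

end

section \<open>Energy and the Carnot-Caratheodory distance\<close>

lemma abs_cont_on_lipschitz:
  fixes f :: "real \<Rightarrow> 'a::metric_space"
  assumes L: "\<And>s t. a \<le> s \<Longrightarrow> s \<le> t \<Longrightarrow> t \<le> b \<Longrightarrow> dist (f t) (f s) \<le> L * (t - s)" and "L \<ge> 0"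
  shows "abs_cont_on a b f"
  unfolding abs_cont_on_def
proof (intro allI impI)
  fix e :: real assume e: "e > 0"
  show "\<exists>\<delta>>0. \<forall>(n::nat) (l::nat \<Rightarrow> real) (r::nat \<Rightarrow> real).
      (\<forall>k<n. a \<le> l k \<and> l k \<le> r k \<and> r k \<le> b) \<and>
      (\<forall>k<n. \<forall>j<n. k \<noteq> j \<longrightarrow> r k \<le> l j \<or> r j \<le> l k) \<and>
      (\<Sum>k<n. r k - l k) < \<delta> \<longrightarrow> (\<Sum>k<n. dist (f (r k)) (f (l k))) < e"
  proof (intro exI[of _ "e / (L + 1)"] conjI allI impI)
    show "e / (L + 1) > 0" using e \<open>L \<ge> 0\<close> by simp
    fix n and l r :: "nat \<Rightarrow> real"
    assume *: "(\<forall>k<n. a \<le> l k \<and> l k \<le> r k \<and> r k \<le> b) \<and>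
      (\<forall>k<n. \<forall>j<n. k \<noteq> j \<longrightarrow> r k \<le> l j \<or> r j \<le> l k) \<and> (\<Sum>k<n. r k - l k) < e / (L + 1)"
    have "(\<Sum>k<n. dist (f (r k)) (f (l k))) \<le> (\<Sum>k<n. L * (r k - l k))"
      using * by (intro sum_mono L) auto
    also have "\<dots> = L * (\<Sum>k<n. r k - l k)" by (simp add: sum_distrib_left)
    also have "\<dots> \<le> L * (e / (L + 1))" using * \<open>L \<ge> 0\<close> by (intro mult_left_mono) auto
    also have "\<dots> < e" using e \<open>L \<ge> 0\<close> by (simp add: field_simps)
    finally show "(\<Sum>k<n. dist (f (r k)) (f (l k))) < e" .
  qed
qed

lemma abs_cont_on_subset:
  assumes ac: "abs_cont_on a b f" and sub: "a \<le> c" "d \<le> b"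
  shows "abs_cont_on c d f"
  unfolding abs_cont_on_def
proof (intro allI impI)
  fix e :: real assume "e > 0"
  from ac[unfolded abs_cont_on_def, THEN spec, THEN mp, OF this] obtain \<delta> where \<delta>: "\<delta> > 0" and *: "\<forall>(n::nat) (l::nat \<Rightarrow> real) (r::nat \<Rightarrow> real).
      (\<forall>k<n. a \<le> l k \<and> l k \<le> r k \<and> r k \<le> b) \<and>
      (\<forall>k<n. \<forall>j<n. k \<noteq> j \<longrightarrow> r k \<le> l j \<or> r j \<le> l k) \<and>
      (\<Sum>k<n. r k - l k) < \<delta> \<longrightarrow> (\<Sum>k<n. dist (f (r k)) (f (l k))) < e"
    by (elim exE conjE)
  show "\<exists>\<delta>>0. \<forall>(n::nat) (l::nat \<Rightarrow> real) (r::nat \<Rightarrow> real).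
      (\<forall>k<n. c \<le> l k \<and> l k \<le> r k \<and> r k \<le> d) \<and>
      (\<forall>k<n. \<forall>j<n. k \<noteq> j \<longrightarrow> r k \<le> l j \<or> r j \<le> l k) \<and>
      (\<Sum>k<n. r k - l k) < \<delta> \<longrightarrow> (\<Sum>k<n. dist (f (r k)) (f (l k))) < e"
  proof (intro exI[of _ \<delta>] conjI allI impI \<delta>)
    fix n :: nat and l r :: "nat \<Rightarrow> real"
    assume "(\<forall>k<n. c \<le> l k \<and> l k \<le> r k \<and> r k \<le> d) \<and>
      (\<forall>k<n. \<forall>j<n. k \<noteq> j \<longrightarrow> r k \<le> l j \<or> r j \<le> l k) \<and> (\<Sum>k<n. r k - l k) < \<delta>"
    with sub show "(\<Sum>k<n. dist (f (r k)) (f (l k))) < e"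
      by (intro *[rule_format] conjI allI impI) force+
  qed
qed

lemma (in step2_group) sum_Xfield: "(\<Sum>i\<in>UNIV. v $ i *\<^sub>R Xfield B i q) = (v, B (fst q) v)"
proof -
  have v: "(\<Sum>i\<in>UNIV. v $ i *\<^sub>R axis i 1) = v"
    by (rule vec_eq_iff[THEN iffD2, rule_format]) (simp add: axis_def if_distrib cong: if_cong)
  have "(\<Sum>i\<in>UNIV. v $ i *\<^sub>R B (fst q) (axis i 1)) = B (fst q) (\<Sum>i\<in>UNIV. v $ i *\<^sub>R axis i 1)"
    by (simp add: B.sum_right B.scaleR_right)
  with v show ?thesis
    by (simp add: Xfield_def prod_eq_iff fst_sum snd_sum)
qed

lemma unit_bdd_norm: "unit_bdd u \<Longrightarrow> unit_bdd (\<lambda>t. norm (u t))"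
  unfolding unit_bdd_def by (auto simp: bounded_norm_comp)

text \<open>The Cauchy-Schwarz inequality, obtained by integrating the square of the deviation of
  the speed from its mean.\<close>

lemma curve_length_sq_le_energy:
  fixes u :: "real \<Rightarrow> real ^ 'm"
  assumes u: "unit_bdd u"
  shows "(curve_length u)\<^sup>2 \<le> energy u"
proof -
  define c where "c = curve_length u"
  have cI: "integral {0..1} (\<lambda>t. norm (u t)) = c"
    using lebesgue_integral_eq_integral[OF unit_bdd_lebesgue_integrable[OF unit_bdd_norm[OF u]]]
    by (simp add: c_def curve_length_def)
  have i1: "(\<lambda>t. norm (u t)) integrable_on {0..1}" by (rule unit_bdd_integrable[OF unit_bdd_norm[OF u]])
  have i2: "(\<lambda>t. u t \<bullet> u t) integrable_on {0..1}" by (intro unit_bdd_integrable unit_bdd_inner u)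
  have "((\<lambda>t. u t \<bullet> u t - 2 * c * norm (u t) + c\<^sup>2) has_integral (energy u - 2 * c * c + c\<^sup>2)) {0..1}"
    using integrable_integral[OF i1] integrable_integral[OF i2] has_integral_const_real[of "c\<^sup>2" 0 1]
    unfolding cI energy_def[symmetric] by (intro has_integral_add has_integral_diff has_integral_mult_right) auto
  moreover have "u t \<bullet> u t - 2 * c * norm (u t) + c\<^sup>2 = (norm (u t) - c)\<^sup>2" for t
    by (simp add: dot_square_norm power2_eq_square algebra_simps)
  ultimately have "((\<lambda>t. (norm (u t) - c)\<^sup>2) has_integral (energy u - 2 * c * c + c\<^sup>2)) {0..1}"
    by (simp only:)
  then have "energy u - 2 * c * c + c\<^sup>2 \<ge> 0"
    by (rule has_integral_nonneg) simp
  then show ?thesis by (simp add: c_def power2_eq_square)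
qed

lemma curve_length_nonneg: "curve_length u \<ge> 0"
  unfolding curve_length_def by simp

context step2_group
begin

text \<open>The derivative is bounded off a finite set, so the curve is Lipschitz and therefore
  absolutely continuous.\<close>

lemma steers_imp_horizontal_curve:
  assumes "steers B u p"
  shows "\<exists>\<gamma>. horizontal_curve B \<gamma> u \<and> \<gamma> 0 = p \<and> \<gamma> 1 = 0"
proof -
  from assms have u: "unit_bdd u" by (simp add: steers_def)
  from assms obtain \<gamma> S where \<gamma>: "continuous_on {0..1} \<gamma>" "\<gamma> 0 = p" "\<gamma> 1 = 0" and S: "finite S"
    and d: "\<And>t. t \<in> {0<..<1} - S \<Longrightarrow> (\<gamma> has_vector_derivative (u t, B (fst (\<gamma> t)) (u t))) (at t)"
    unfolding steers_def by blast
  obtain U where U: "U \<ge> 0" "\<And>t. t \<in> {0..1} \<Longrightarrow> norm (u t) \<le> U"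
    using unit_bddE[OF u] by blast
  have "unit_bdd (\<lambda>t. B (fst (\<gamma> t)) (u t))"
    by (rule unit_bdd_B[OF unit_bdd_continuous u]) (intro continuous_intros \<gamma>)
  then obtain W where W: "W \<ge> 0" "\<And>t. t \<in> {0..1} \<Longrightarrow> norm (B (fst (\<gamma> t)) (u t)) \<le> W"
    using unit_bddE by blast
  have "dist (\<gamma> t) (\<gamma> s) \<le> (U + W) * (t - s)" if st: "0 \<le> s" "s \<le> t" "t \<le> 1" for s t
  proof -
    have "((\<lambda>t. (u t, B (fst (\<gamma> t)) (u t))) has_integral (\<gamma> t - \<gamma> s)) {s..t}"
      by (rule fundamental_theorem_of_calculus_interior_strong[OF S st(2)])
        (use st d in \<open>auto intro: continuous_on_subset[OF \<gamma>(1)]\<close>)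
    then have "norm (\<gamma> t - \<gamma> s) \<le> (U + W) * measure lborel {s..t}"
    proof (rule has_integral_bound_real[of "U + W" "{}", rotated 2])
      fix r assume "r \<in> {s..t} - {}"
      then have "r \<in> {0..1}" using st by auto
      then show "norm (u r, B (fst (\<gamma> r)) (u r)) \<le> U + W"
        using norm_Pair_le[of "u r" "B (fst (\<gamma> r)) (u r)"] U(2)[of r] W(2)[of r] by linarith
    qed (use U W in auto)
    then show ?thesis using st by (simp add: dist_norm)
  qed
  then have "abs_cont_on 0 1 \<gamma>"
    using U(1) W(1) by (intro abs_cont_on_lipschitz[of _ _ _ "U + W"]) auto
  moreover have "AE t in lebesgue_on {0..1}.
        (\<gamma> has_vector_derivative (\<Sum>i\<in>UNIV. u t $ i *\<^sub>R Xfield B i (\<gamma> t))) (at t within {0..1})"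
  proof -
    \<comment> \<open>The end points join the exceptional set because \<open>steers\<close> gives
      derivatives only in the open interval.\<close>
    have "negligible (insert 0 (insert 1 S))" using S by (intro negligible_finite) auto
    then have "AE t in lebesgue. t \<notin> insert 0 (insert 1 S)"
      by (intro AE_not_in) (simp add: negligible_iff_null_sets)
    then have "AE t in lebesgue. t \<in> {0..1} \<longrightarrow> t \<notin> insert 0 (insert 1 S)"
      by (rule eventually_mono) (rule impI)
    then have "AE t in lebesgue_on {0..1}. t \<notin> insert 0 (insert 1 S)"
      using AE_restrict_space_iff[of "{0..1}" lebesgue "\<lambda>t. t \<notin> insert 0 (insert 1 S)"] by simp
    moreover have "AE t in lebesgue_on {0..1}. t \<in> {0..1::real}"
      using AE_space[of "lebesgue_on {0..1::real}"] by simp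
    ultimately show ?thesis
    proof eventually_elim
      case (elim t)
      then have "(\<gamma> has_vector_derivative (u t, B (fst (\<gamma> t)) (u t))) (at t)" by (intro d) auto
      then show ?case unfolding sum_Xfield by (rule has_vector_derivative_at_within)
    qed
  qed
  ultimately show ?thesis
    unfolding horizontal_curve_def
    by (intro exI[of _ \<gamma>] conjI unit_bdd_lebesgue_integrable[OF u] \<gamma>(2,3))
qed

section \<open>Approximation of horizontal curves by lifted polygons\<close>

text \<open>The polygon through the \<open>X i\<close> is lifted to a horizontal curve, spending
  time \<open>1 / N\<close> on each edge; edges of length at most \<open>L / N\<close> then give
  speed at most \<open>L\<close>. The starting height is chosen so that the lift ends at 0.\<close>

lemma polygon_steers:
  fixes X :: "nat \<Rightarrow> real ^ 'm"
  assumes N: "N > 0" and XN: "X N = 0" and XL: "\<And>i. i < N \<Longrightarrow> norm (X (Suc i) - X i) \<le> L / real N" and L: "L \<ge> 0"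
  shows "\<exists>u. steers B u (X 0, - (\<Sum>i<N. B (X i) (X (Suc i) - X i))) \<and> energy u \<le> L\<^sup>2"
proof -
  \<comment> \<open>The displacement of the lift along edge \<open>i\<close>. The lift of an edge is
    a straight segment, because \<open>B\<close> vanishes on parallel vectors.\<close>
  define D where "D i = (X (Suc i) - X i, B (X i) (X (Suc i) - X i))" for i
  \<comment> \<open>Clamping yields one formula for the whole curve: edge \<open>i\<close>
    contributes nothing before its time interval and all of \<open>D i\<close> after it.\<close>
  define cl where "cl s = max 0 (min 1 s)" for s :: real
  define p0 where "p0 = (X 0, - (\<Sum>i<N. B (X i) (X (Suc i) - X i)))"
  define \<gamma> where "\<gamma> t = p0 + (\<Sum>i<N. cl (real N * t - real i) *\<^sub>R D i)" for t
  define I where "I i = {t::real. real i < real N * t \<and> real N * t < real (Suc i)}" for i :: nat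
  \<comment> \<open>The intervals \<open>I i\<close> are open, so the control is 0 at the vertices
    and the bound \<open>L\<close> holds everywhere.\<close>
  define u where "u t = (\<Sum>i<N. indicat_real (I i) t *\<^sub>R (real N *\<^sub>R (X (Suc i) - X i)))" for t
  have Iopen: "open (I i)" for i
    unfolding I_def by (intro open_Collect_conj open_Collect_less continuous_intros)
  have Iuniq: "i = j" if "t \<in> I i" "t \<in> I j" for t i j
  proof -
    have "real i < real (Suc j)" "real j < real (Suc i)" using that unfolding I_def by auto
    then show ?thesis by linarith
  qed
  have u_I: "u t = real N *\<^sub>R (X (Suc i) - X i)" if "i < N" "t \<in> I i" for i t
  proof -
    have "u t = (\<Sum>j\<in>{i}. indicat_real (I j) t *\<^sub>R (real N *\<^sub>R (X (Suc j) - X j)))"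
      unfolding u_def
    proof (rule sum.mono_neutral_right)
      show "\<forall>j\<in>{..<N} - {i}. indicat_real (I j) t *\<^sub>R (real N *\<^sub>R (X (Suc j) - X j)) = 0"
        using Iuniq[OF that(2)] by (auto simp: indicator_def)
    qed (use that in auto)
    then show ?thesis using that by simp
  qed
  have un: "norm (u t) \<le> L" for t
  proof (cases "\<exists>i<N. t \<in> I i")
    case True
    then obtain i where i: "i < N" "t \<in> I i" by blast
    have "norm (u t) = real N * norm (X (Suc i) - X i)" by (simp add: u_I[OF i])
    also have "\<dots> \<le> real N * (L / real N)" by (intro mult_left_mono XL i) auto
    finally show ?thesis using N by simp
  next
    case False
    then have "u t = 0" unfolding u_def by (intro sum.neutral) (auto simp: indicator_def)
    then show ?thesis using L by simp
  qed
  have "u \<in> borel_measurable borel"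
    unfolding u_def using Iopen
    by (intro borel_measurable_sum borel_measurable_scaleR borel_measurable_indicator borel_measurable_const) auto
  then have "u \<in> borel_measurable (lebesgue_on {0..1})"
    by (intro measurable_restrict_space1 measurable_completion) simp
  then have ub: "unit_bdd u"
    unfolding unit_bdd_def bounded_iff using un by blast
  have \<gamma>c: "continuous_on {0..1} \<gamma>"
    unfolding \<gamma>_def cl_def by (intro continuous_intros)
  have \<gamma>_I: "\<gamma> t = p0 + (\<Sum>j<i. D j) + (real N * t - real i) *\<^sub>R D i" if i: "i < N" "t \<in> I i" for i t
  proof -
    have t: "real i < real N * t" "real N * t < real i + 1" using i by (auto simp: I_def)
    have "(\<Sum>j<N. cl (real N * t - real j) *\<^sub>R D j) = (\<Sum>j<Suc i. cl (real N * t - real j) *\<^sub>R D j)"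
    proof (rule sum.mono_neutral_right)
      show "\<forall>j\<in>{..<N} - {..<Suc i}. cl (real N * t - real j) *\<^sub>R D j = 0"
      proof
        fix j assume "j \<in> {..<N} - {..<Suc i}"
        then have "real i + 1 \<le> real j" by auto
        then show "cl (real N * t - real j) *\<^sub>R D j = 0" using t by (simp add: cl_def)
      qed
    qed (use i in auto)
    also have "\<dots> = (\<Sum>j<i. cl (real N * t - real j) *\<^sub>R D j) + cl (real N * t - real i) *\<^sub>R D i"
      by (rule sum.lessThan_Suc)
    also have "(\<Sum>j<i. cl (real N * t - real j) *\<^sub>R D j) = (\<Sum>j<i. D j)"
    proof (rule sum.cong[OF refl])
      fix j assume "j \<in> {..<i}"
      then have "real j + 1 \<le> real i" by auto
      then show "cl (real N * t - real j) *\<^sub>R D j = D j" using t by (simp add: cl_def)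
    qed
    also have "cl (real N * t - real i) = real N * t - real i" using t by (simp add: cl_def)
    finally show ?thesis by (simp add: \<gamma>_def)
  qed
  have sumX: "X 0 + (\<Sum>j<i. X (Suc j) - X j) = X i" for i
    by (simp add: sum_lessThan_telescope)
  define S where "S = (\<lambda>i. real i / real N) ` {..N}"
  have "finite S" by (simp add: S_def)
  moreover have "(\<gamma> has_vector_derivative (u t, B (fst (\<gamma> t)) (u t))) (at t)" if t: "t \<in> {0<..<1} - S" for t
  proof -
    define i where "i = nat \<lfloor>real N * t\<rfloor>"
    have t01: "0 < t" "t < 1" using t by auto
    have Nt: "0 < real N * t" "real N * t < real N" using t01 N by auto
    have ri: "real i = of_int \<lfloor>real N * t\<rfloor>" using Nt by (simp add: i_def)
    have i1: "real i \<le> real N * t" "real N * t < real i + 1" unfolding ri by linarith+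
    have iN: "i < N" using i1 Nt by linarith
    have "real N * t \<noteq> real i"
    proof
      assume "real N * t = real i"
      then have "t = real i / real N" using N by (simp add: field_simps)
      then have "t \<in> S" using iN by (auto simp: S_def)
      then show False using t by auto
    qed
    then have tI: "t \<in> I i" using i1 by (auto simp: I_def)
    have "((\<lambda>s. p0 + (\<Sum>j<i. D j) + (real N * s - real i) *\<^sub>R D i) has_vector_derivative (real N *\<^sub>R D i)) (at t)"
      by (auto intro!: derivative_eq_intros)
    then have "(\<gamma> has_vector_derivative (real N *\<^sub>R D i)) (at t)"
      by (rule has_vector_derivative_transform_within_open[OF _ Iopen tI]) (simp add: \<gamma>_I[OF iN])
    moreover have "fst (\<gamma> t) = X i + (real N * t - real i) *\<^sub>R (X (Suc i) - X i)"
      using sumX[of i] unfolding \<gamma>_I[OF iN tI] by (simp add: D_def p0_def fst_sum)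
    then have "B (fst (\<gamma> t)) (u t) = real N *\<^sub>R B (X i) (X (Suc i) - X i)"
      unfolding u_I[OF iN tI] by (simp only: B.add_left B.scaleR_left B.scaleR_right B_self scaleR_zero_right add_0_right)
    then have "real N *\<^sub>R D i = (u t, B (fst (\<gamma> t)) (u t))"
      using u_I[OF iN tI] by (simp add: D_def)
    ultimately show ?thesis by simp
  qed
  moreover have "\<gamma> 0 = p0"
    by (simp add: \<gamma>_def cl_def)
  moreover have "\<gamma> 1 = 0"
  proof -
    have "(\<Sum>i<N. cl (real N * 1 - real i) *\<^sub>R D i) = (\<Sum>i<N. D i)"
    proof (rule sum.cong[OF refl])
      fix i assume "i \<in> {..<N}"
      then have "real i + 1 \<le> real N" by auto
      then show "cl (real N * 1 - real i) *\<^sub>R D i = D i" by (simp add: cl_def)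
    qed
    then have "\<gamma> 1 = p0 + (\<Sum>i<N. D i)" by (simp add: \<gamma>_def)
    also have "\<dots> = 0"
      using sumX[of N] XN by (simp add: prod_eq_iff p0_def D_def fst_sum snd_sum)
    finally show ?thesis .
  qed
  ultimately have "steers B u p0"
    unfolding steers_def using ub \<gamma>c by (intro conjI exI[of _ \<gamma>] exI[of _ S]) auto
  moreover have "energy u \<le> L\<^sup>2"
  proof -
    have "energy u \<le> integral {0..1::real} (\<lambda>t. L\<^sup>2)"
      unfolding energy_def
    proof (rule integral_le)
      show "(\<lambda>t. u t \<bullet> u t) integrable_on {0..1}" by (intro unit_bdd_integrable unit_bdd_inner ub)
      show "u t \<bullet> u t \<le> L\<^sup>2" for t using power_mono[OF un[of t], of 2] by (simp add: dot_square_norm)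
    qed auto
    then show ?thesis by simp
  qed
  ultimately show ?thesis unfolding p0_def by blast
qed

text \<open>A single edge takes care of the horizontal part and a vertical shift of the rest. This
  ensures that the infimum defining the distance is over a nonempty set.\<close>

lemma ex_steers: "\<exists>u. steers B u p"
proof -
  define X where "X i = (if i = 0 then fst p else 0)" for i :: nat
  obtain u where u: "steers B u (X 0, - (\<Sum>i<1. B (X i) (X (Suc i) - X i)))"
    using polygon_steers[of 1 X "norm (fst p)"] by (auto simp: X_def)
  then have "steers B u (fst p, 0)" by (simp add: X_def B.minus_right)
  then show ?thesis
    using steers_shift_vertical[of "\<exists>u. steers B u p"]
    by (metis add_0 fst_conv prod.collapse snd_conv)
qed

text \<open>The second bound is quadratic because the deviation from the lifted chord is the
  integral of \<open>B (fst (\<gamma> t) - fst (\<gamma> a)) (u t)\<close>, in which both arguments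
  are controlled by the length of the arc. A majorant \<open>g\<close> is allowed so that the speed
  can be made positive.\<close>

lemma horizontal_curve_increments:
  assumes h: "horizontal_curve B \<gamma> u" and ab: "0 \<le> a" "a \<le> b" "b \<le> 1"
    and K: "\<And>x y. norm (B x y) \<le> norm x * norm y * K" "K \<ge> 0"
    and g: "(\<lambda>t. g t) integrable_on {0..1}" "\<And>t. norm (u t) \<le> g t"
  shows "norm (fst (\<gamma> b) - fst (\<gamma> a)) \<le> integral {a..b} g"
    and "norm (snd (\<gamma> b) - snd (\<gamma> a) - B (fst (\<gamma> a)) (fst (\<gamma> b) - fst (\<gamma> a))) \<le> (integral {a..b} g)\<^sup>2 * K"
proof -
  have g0: "g t \<ge> 0" for t using g(2)[of t] norm_ge_zero order_trans by blast
  have gi: "g integrable_on {c..d}" if "0 \<le> c" "d \<le> 1" for c d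
    by (rule integrable_on_subinterval[OF g(1)]) (use that in auto)
  define N where "N = {t\<in>{0..1}. \<not> (\<gamma> has_vector_derivative (u t, B (fst (\<gamma> t)) (u t))) (at t within {0..1})}"
  have "AE t in lebesgue_on {0..1}. (\<gamma> has_vector_derivative (u t, B (fst (\<gamma> t)) (u t))) (at t within {0..1})"
    using h unfolding horizontal_curve_def sum_Xfield by simp
  then have "AE t in lebesgue. t \<in> {0..1} \<longrightarrow> (\<gamma> has_vector_derivative (u t, B (fst (\<gamma> t)) (u t))) (at t within {0..1})"
    by (subst (asm) AE_restrict_space_iff) auto
  then obtain M where M: "{t \<in> space lebesgue. \<not> (t \<in> {0..1} \<longrightarrow> (\<gamma> has_vector_derivative (u t, B (fst (\<gamma> t)) (u t))) (at t within {0..1}))} \<subseteq> M"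
     "M \<in> null_sets lebesgue"
    by (auto elim!: AE_E simp: null_sets_def)
  then have "N \<subseteq> M" by (auto simp: N_def)
  then have N: "negligible N"
    using M(2) negligible_iff_null_sets negligible_subset by blast
  have ac: "abs_cont_on 0 1 \<gamma>" using h by (simp add: horizontal_curve_def)
  have FTC: "((\<lambda>t. (u t, B (fst (\<gamma> t)) (u t))) has_integral (\<gamma> d - \<gamma> c)) {c..d}" if "0 \<le> c" "c \<le> d" "d \<le> 1" for c d
  proof (rule abs_cont_on_FTC[OF abs_cont_on_subset[OF ac] _ N])
    fix t assume "t \<in> {c..d} - N"
    then have "(\<gamma> has_vector_derivative (u t, B (fst (\<gamma> t)) (u t))) (at t within {0..1})"
      using that by (auto simp: N_def)
    then show "(\<gamma> has_vector_derivative (u t, B (fst (\<gamma> t)) (u t))) (at t within {c..d})"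
      by (rule has_vector_derivative_within_subset) (use that in auto)
  qed (use that in auto)
  have incr: "norm (fst (\<gamma> d) - fst (\<gamma> c)) \<le> integral {c..d} g" if cd: "0 \<le> c" "c \<le> d" "d \<le> 1" for c d
  proof -
    have "(u has_integral (fst (\<gamma> d) - fst (\<gamma> c))) {c..d}"
      using has_integral_linear[OF FTC[OF cd] bounded_linear_fst] by (simp add: o_def)
    then show ?thesis
      using integral_norm_bound_integral[of u "{c..d}" g] gi[OF cd(1,3)] g(2)
      by (simp add: has_integral_integrable integral_unique)
  qed
  show "norm (fst (\<gamma> b) - fst (\<gamma> a)) \<le> integral {a..b} g" by (rule incr[OF ab])
  define G where "G = integral {a..b} g"
  have G0: "G \<ge> 0" unfolding G_def by (rule integral_nonneg[OF gi[OF ab(1,3)]]) (use g0 in auto)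
  have "((\<lambda>t. B (fst (\<gamma> t)) (u t) - B (fst (\<gamma> a)) (u t)) has_integral
      (snd (\<gamma> b - \<gamma> a) - B (fst (\<gamma> a)) (fst (\<gamma> b - \<gamma> a)))) {a..b}"
    using has_integral_linear[OF FTC[OF ab], of "\<lambda>q. snd q - B (fst (\<gamma> a)) (fst q)"]
    by (simp add: o_def bounded_linear_sub bounded_linear_snd bounded_linear_compose[OF B.bounded_linear_right bounded_linear_fst])
  then have hi: "((\<lambda>t. B (fst (\<gamma> t) - fst (\<gamma> a)) (u t)) has_integral
      (snd (\<gamma> b) - snd (\<gamma> a) - B (fst (\<gamma> a)) (fst (\<gamma> b) - fst (\<gamma> a)))) {a..b}"
    by (simp add: B.diff_left)
  have "norm (integral {a..b} (\<lambda>t. B (fst (\<gamma> t) - fst (\<gamma> a)) (u t))) \<le> integral {a..b} (\<lambda>t. G * K * g t)"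
  proof (rule integral_norm_bound_integral)
    show "(\<lambda>t. B (fst (\<gamma> t) - fst (\<gamma> a)) (u t)) integrable_on {a..b}" using hi by (rule has_integral_integrable)
    show "(\<lambda>t. G * K * g t) integrable_on {a..b}" by (rule integrable_on_mult_right[OF gi[OF ab(1,3)]])
    fix t assume t: "t \<in> {a..b}"
    have "norm (fst (\<gamma> t) - fst (\<gamma> a)) \<le> integral {a..t} g" by (rule incr) (use t ab in auto)
    also have "\<dots> \<le> G" unfolding G_def
      by (rule integral_subset_le) (use t ab gi g0 in auto)
    finally have "norm (fst (\<gamma> t) - fst (\<gamma> a)) * norm (u t) \<le> G * g t"
      by (intro mult_mono g(2) G0) auto
    then have "norm (fst (\<gamma> t) - fst (\<gamma> a)) * norm (u t) * K \<le> G * g t * K" by (rule mult_right_mono[OF _ K(2)])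
    then show "norm (B (fst (\<gamma> t) - fst (\<gamma> a)) (u t)) \<le> G * K * g t"
      using K(1)[of "fst (\<gamma> t) - fst (\<gamma> a)" "u t"] by (simp add: mult_ac)
  qed
  then show "norm (snd (\<gamma> b) - snd (\<gamma> a) - B (fst (\<gamma> a)) (fst (\<gamma> b) - fst (\<gamma> a))) \<le> G\<^sup>2 * K"
    using integral_unique[OF hi] by (simp add: G_def power2_eq_square mult_ac)
qed

end

text \<open>The primitive of \<open>g\<close> attains every multiple of the mass divided by
  \<open>N\<close> by the intermediate value theorem, and the lower bound \<eta> makes it strictly
  increasing, which puts the points in order.\<close>

lemma equal_mass_partition:
  fixes g :: "real \<Rightarrow> real"
  assumes g: "g integrable_on {0..1}" and pos: "\<And>t. g t \<ge> \<eta>" "\<eta> > 0" and N: "N > 0"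
  obtains \<tau> :: "nat \<Rightarrow> real" where "\<tau> 0 = 0" "\<tau> N = 1" "\<And>i. i \<le> N \<Longrightarrow> \<tau> i \<in> {0..1}"
    "\<And>i. i < N \<Longrightarrow> \<tau> i \<le> \<tau> (Suc i)"
    "\<And>i. i < N \<Longrightarrow> integral {\<tau> i..\<tau> (Suc i)} g = integral {0..1} g / real N"
proof -
  define s where "s t = integral {0..t} g" for t
  define L where "L = integral {0..1} g"
  have gi: "g integrable_on {c..d}" if "0 \<le> c" "d \<le> 1" for c d
    by (rule integrable_on_subinterval[OF g]) (use that in auto)
  have comb: "s d - s c = integral {c..d} g" if "0 \<le> c" "c \<le> d" "d \<le> 1" for c d
    using Henstock_Kurzweil_Integration.integral_combine[OF that(1,2) gi[of 0 d]] that by (simp add: s_def)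
  have mono: "s c + \<eta> * (d - c) \<le> s d" if cd: "0 \<le> c" "c \<le> d" "d \<le> 1" for c d
  proof -
    have "integral {c..d} (\<lambda>t. \<eta>) \<le> integral {c..d} g"
      by (rule integral_le) (use gi cd pos in auto)
    then show ?thesis using comb[OF cd] cd by (simp add: mult.commute)
  qed
  have sless: "s c < s d" if "0 \<le> c" "c < d" "d \<le> 1" for c d
  proof -
    have "\<eta> * (d - c) > 0" using that pos by simp
    then show ?thesis using mono[of c d] that by linarith
  qed
  have sc: "continuous_on {0..1} s" unfolding s_def by (rule indefinite_integral_continuous_1[OF g])
  have s0: "s 0 = 0" and s1: "s 1 = L" by (simp_all add: s_def L_def)
  have L: "L > 0" using sless[of 0 1] s0 s1 by simp
  have "\<exists>t. 0 \<le> t \<and> t \<le> 1 \<and> s t = real i * L / real N" if "i \<le> N" for i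
  proof (rule IVT')
    have "real i / real N \<le> 1" using that N by simp
    then have "L * (real i / real N) \<le> L * 1" using L by (intro mult_left_mono) auto
    then show "real i * L / real N \<le> s 1" using s1 by (simp add: mult.commute)
  qed (use s0 L sc in auto)
  then obtain \<tau> where \<tau>: "\<And>i. i \<le> N \<Longrightarrow> 0 \<le> \<tau> i \<and> \<tau> i \<le> 1 \<and> s (\<tau> i) = real i * L / real N" by metis
  have \<tau>0: "\<tau> 0 = 0"
    using \<tau>[of 0] sless[of 0 "\<tau> 0"] s0 by fastforce
  have \<tau>N: "\<tau> N = 1"
    using \<tau>[of N] sless[of "\<tau> N" 1] s1 N by fastforce
  have le: "\<tau> i \<le> \<tau> (Suc i)" if "i < N" for i
  proof (rule ccontr)
    assume "\<not> \<tau> i \<le> \<tau> (Suc i)"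
    then have "s (\<tau> (Suc i)) < s (\<tau> i)" using \<tau>[of i] \<tau>[of "Suc i"] that by (intro sless) auto
    then have "(1 + real i) * L / real N < real i * L / real N" using \<tau>[of i] \<tau>[of "Suc i"] that by simp
    then show False using L N by (simp add: divide_less_cancel)
  qed
  have "integral {\<tau> i..\<tau> (Suc i)} g = L / real N" if "i < N" for i
  proof -
    have "integral {\<tau> i..\<tau> (Suc i)} g = real (Suc i) * L / real N - real i * L / real N"
      using comb[of "\<tau> i" "\<tau> (Suc i)"] le[OF that] \<tau>[of i] \<tau>[of "Suc i"] that by simp
    also have "\<dots> = L / real N" by (simp add: algebra_simps add_divide_distrib)
    finally show ?thesis .
  qed
  then show thesis using \<tau>0 \<tau>N le \<tau> by (intro that[of \<tau>]) (auto simp: L_def)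
qed

context step2_group
begin

text \<open>The curve is cut into \<open>N\<close> arcs of equal length and replaced by the lifted
  polygon through the division points. Traversing equal arcs in equal times turns the length bound
  into an energy bound, and the small vertical defect is removed by
  \<open>steers_shift_vertical\<close>.\<close>

lemma horizontal_curve_approx_steers:
  assumes h: "horizontal_curve B \<gamma> u" "\<gamma> 0 = p" "\<gamma> 1 = 0" and e: "e > 0"
  shows "\<exists>u'. steers B u' p \<and> energy u' \<le> (curve_length u + e)\<^sup>2 + e"
proof -
  obtain K where K: "K \<ge> 0" "\<And>x y. norm (B x y) \<le> norm x * norm y * K"
    using B.nonneg_bounded by blast
  obtain C where C: "C \<ge> 0"
    "\<And>u p z. steers B u p \<Longrightarrow> \<exists>u'. steers B u' (fst p, snd p + z) \<and> energy u' \<le> energy u + C * norm z"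
    using steers_shift_vertical by blast
  \<comment> \<open>The summand \<open>e\<close> makes the reparametrization strictly increasing where the speed \<open>norm (u t)\<close> vanishes.\<close>
  define g where "g t = norm (u t) + e" for t
  have ui: "integrable (lebesgue_on {0..1}) (\<lambda>t. norm (u t))"
    using h(1) by (simp add: horizontal_curve_def)
  have ui': "(\<lambda>t. norm (u t)) integrable_on {0..1}"
    by (rule integrable_on_lebesgue_on[OF ui]) simp
  have g: "g integrable_on {0..1}"
    unfolding g_def by (intro integrable_add ui') auto
  define L where "L = curve_length u + e"
  have gL: "integral {0..1} g = L"
  proof -
    have "integral\<^sup>L (lebesgue_on {0..1}) (\<lambda>t. norm (u t)) = integral {0..1} (\<lambda>t. norm (u t))"
      by (rule lebesgue_integral_eq_integral[OF ui]) simp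
    then show ?thesis
      unfolding g_def L_def curve_length_def using ui' by (subst integral_add) auto
  qed
  have L: "L > 0" using curve_length_nonneg[of u] e by (simp add: L_def)
  \<comment> \<open>The vertical defects of \<open>N\<close> arcs sum to at most
    \<open>K * L\<^sup>2 / N\<close>, and removing them costs at most \<open>C\<close> times
    that.\<close>
  obtain N :: nat where N: "real N > C * K * L\<^sup>2 / e" "N > 0"
  proof -
    obtain N :: nat where "max 0 (C * K * L\<^sup>2 / e) < real N" using reals_Archimedean2 by blast
    then show thesis by (intro that[of N]) auto
  qed
  have ge: "g t \<ge> e" for t by (simp add: g_def)
  obtain \<tau> where \<tau>: "\<tau> 0 = 0" "\<tau> N = 1" "\<And>i. i \<le> N \<Longrightarrow> \<tau> i \<in> {0..1}"
    "\<And>i. i < N \<Longrightarrow> \<tau> i \<le> \<tau> (Suc i)"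
    "\<And>i. i < N \<Longrightarrow> integral {\<tau> i..\<tau> (Suc i)} g = L / real N"
    using equal_mass_partition[OF g ge e N(2), unfolded gL] by blast
  define X where "X i = fst (\<gamma> (\<tau> i))" for i
  define Z where "Z i = snd (\<gamma> (\<tau> i))" for i
  have inc: "norm (X (Suc i) - X i) \<le> L / real N"
    "norm (Z (Suc i) - Z i - B (X i) (X (Suc i) - X i)) \<le> (L / real N)\<^sup>2 * K" if i: "i < N" for i
  proof -
    have ug: "norm (u t) \<le> g t" for t using e by (simp add: g_def)
    have "0 \<le> \<tau> i" "\<tau> (Suc i) \<le> 1" using \<tau>(3)[of i] \<tau>(3)[of "Suc i"] i by auto
    from horizontal_curve_increments[OF h(1) this(1) \<tau>(4)[OF i] this(2) K(2,1) g ug]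
    show "norm (X (Suc i) - X i) \<le> L / real N"
      "norm (Z (Suc i) - Z i - B (X i) (X (Suc i) - X i)) \<le> (L / real N)\<^sup>2 * K"
      unfolding X_def Z_def \<tau>(5)[OF i] by simp_all
  qed
  have "X N = 0" "X 0 = fst p" "Z N = 0" "Z 0 = snd p" using \<tau>(1,2) h by (simp_all add: X_def Z_def)
  define z where "z = (\<Sum>i<N. Z (Suc i) - Z i - B (X i) (X (Suc i) - X i))"
  obtain u1 where u1: "steers B u1 (X 0, - (\<Sum>i<N. B (X i) (X (Suc i) - X i)))" "energy u1 \<le> L\<^sup>2"
    using polygon_steers[of N X L] N(2) \<open>X N = 0\<close> inc(1) L by auto
  have z_eq: "z = - snd p - (\<Sum>i<N. B (X i) (X (Suc i) - X i))"
    using sum_lessThan_telescope[of Z N] \<open>Z N = 0\<close> \<open>Z 0 = snd p\<close>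
    by (simp add: z_def sum_subtractf[of "\<lambda>i. Z (Suc i) - Z i"])
  obtain u2 where u2: "steers B u2 (X 0, - (\<Sum>i<N. B (X i) (X (Suc i) - X i)) + (- z))" "energy u2 \<le> energy u1 + C * norm (- z)"
    using C(2)[OF u1(1), of "- z"] by auto
  have "steers B u2 p" using u2(1) \<open>X 0 = fst p\<close> by (simp add: z_eq)
  moreover have "norm z \<le> (\<Sum>i<N. (L / real N)\<^sup>2 * K)"
    unfolding z_def by (rule sum_norm_le) (use inc(2) in auto)
  then have "C * norm z \<le> C * (K * L\<^sup>2 / real N)"
    using N(2) C(1) by (intro mult_left_mono) (auto simp: power2_eq_square field_simps)
  moreover have "C * (K * L\<^sup>2 / real N) \<le> e"
    using N e by (simp add: field_simps)
  ultimately show ?thesis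
    using u1(2) u2(2) unfolding L_def by (intro exI[of _ u2]) auto
qed

section \<open>The squared distance as an infimum of energies\<close>

definition dsq :: "('m, 'k) cpt \<Rightarrow> real" where
  "dsq p = (cc_dist B p 0)\<^sup>2"

lemma cc_dist_nonneg: "cc_dist B p 0 \<ge> 0"
proof -
  obtain u where "steers B u p" using ex_steers by blast
  from steers_imp_horizontal_curve[OF this]
  show ?thesis unfolding cc_dist_def
    by (intro cInf_greatest) (auto simp: curve_length_nonneg)
qed

lemma dsq_le_energy: "steers B u p \<Longrightarrow> dsq p \<le> energy u"
proof -
  assume st: "steers B u p"
  obtain \<gamma> where \<gamma>: "horizontal_curve B \<gamma> u" "\<gamma> 0 = p" "\<gamma> 1 = 0"
    using steers_imp_horizontal_curve[OF st] by blast
  have "cc_dist B p 0 \<le> curve_length u"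
    unfolding cc_dist_def
  proof (rule cInf_lower)
    show "bdd_below {curve_length u |\<gamma> u. horizontal_curve B \<gamma> u \<and> \<gamma> 0 = p \<and> \<gamma> 1 = 0}"
      by (rule bdd_belowI[of _ 0]) (auto simp: curve_length_nonneg)
  qed (use \<gamma> in blast)
  then have "dsq p \<le> (curve_length u)\<^sup>2"
    unfolding dsq_def by (rule power_mono[OF _ cc_dist_nonneg])
  also have "\<dots> \<le> energy u"
    by (rule curve_length_sq_le_energy) (use st in \<open>simp add: steers_def\<close>)
  finally show ?thesis .
qed

text \<open>Together with \<open>dsq_le_energy\<close> this identifies the squared distance with the
  infimum of the energy over bounded controls.\<close>

lemma dsq_approx:
  assumes e: "e > 0"
  shows "\<exists>u. steers B u p \<and> energy u < dsq p + e"
proof -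
  define d where "d = cc_dist B p 0"
  have d: "d \<ge> 0" using cc_dist_nonneg by (simp add: d_def)
  \<comment> \<open>For \<open>r\<close> at most 1, \<open>(d + 2 * r)\<^sup>2 + r\<close> exceeds
    \<open>d\<^sup>2\<close> by at most \<open>r * (4 * d + 5)\<close>, which is less than
    \<open>e\<close>.\<close>
  define r where "r = min 1 (e / (4 * d + 6))"
  have r: "r > 0" "r \<le> 1" using e d by (auto simp: r_def)
  have "r \<le> e / (4 * d + 6)" by (simp add: r_def)
  then have r2: "r * (4 * d + 6) \<le> e" using d by (subst (asm) pos_le_divide_eq) auto
  obtain u0 where "steers B u0 p" using ex_steers by blast
  from steers_imp_horizontal_curve[OF this]
  have "{curve_length u |\<gamma> u. horizontal_curve B \<gamma> u \<and> \<gamma> 0 = p \<and> \<gamma> 1 = 0} \<noteq> {}" by blast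
  moreover have "Inf {curve_length u |\<gamma> u. horizontal_curve B \<gamma> u \<and> \<gamma> 0 = p \<and> \<gamma> 1 = 0} < d + r"
    using r by (simp add: d_def cc_dist_def)
  ultimately have "\<exists>l\<in>{curve_length u |\<gamma> u. horizontal_curve B \<gamma> u \<and> \<gamma> 0 = p \<and> \<gamma> 1 = 0}. l < d + r"
    by (rule cInf_lessD)
  then obtain \<gamma> u where \<gamma>: "horizontal_curve B \<gamma> u" "\<gamma> 0 = p" "\<gamma> 1 = 0" "curve_length u < d + r" by auto
  obtain u' where u': "steers B u' p" "energy u' \<le> (curve_length u + r)\<^sup>2 + r"
    using horizontal_curve_approx_steers[OF \<gamma>(1-3) r(1)] by blast
  have "(curve_length u + r)\<^sup>2 \<le> (d + 2 * r)\<^sup>2"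
    using \<gamma>(4) curve_length_nonneg[of u] r by (intro power_mono) auto
  also have "\<dots> = d\<^sup>2 + r * (4 * d) + 4 * (r * r)" by (simp add: power2_eq_square algebra_simps)
  also have "r * r \<le> r * 1" using r by (intro mult_left_mono) auto
  finally have "energy u' \<le> d\<^sup>2 + r * (4 * d) + 5 * r" using u'(2) by linarith
  also have "\<dots> < d\<^sup>2 + r * (4 * d + 6)" using r by (simp add: algebra_simps)
  finally have "energy u' < d\<^sup>2 + e" using r2 by linarith
  then show ?thesis using u'(1) by (auto simp: dsq_def d_def)
qed

lemma dsq_vertical:
  obtains C where "C \<ge> 0" "\<And>x z w. dsq (x, z + w) \<le> dsq (x, z) + C * norm w"
proof -
  obtain C where C: "C \<ge> 0"
    "\<And>u p z. steers B u p \<Longrightarrow> \<exists>u'. steers B u' (fst p, snd p + z) \<and> energy u' \<le> energy u + C * norm z"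
    using steers_shift_vertical by blast
  have "dsq (x, z + w) \<le> dsq (x, z) + C * norm w" for x z w
  proof (rule field_le_epsilon)
    fix e :: real assume "e > 0"
    then obtain u where u: "steers B u (x, z)" "energy u < dsq (x, z) + e" using dsq_approx by blast
    obtain u' where u': "steers B u' (x, z + w)" "energy u' \<le> energy u + C * norm w"
      using C(2)[OF u(1), of w] by auto
    show "dsq (x, z + w) \<le> dsq (x, z) + C * norm w + e"
      using dsq_le_energy[OF u'(1)] u'(2) u(2) by linarith
  qed
  then show thesis using C(1) by (intro that)
qed

end

section \<open>Test functions\<close>

lemma power_dvd_pderiv:
  fixes p q :: "real poly"
  assumes "q ^ Suc k dvd p"
  shows "q ^ k dvd pderiv p"
proof -
  obtain r where "p = q ^ Suc k * r" using assms by (rule dvdE)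
  then have "pderiv p = q ^ Suc k * pderiv r + r * (smult (real (Suc k)) (q ^ k) * pderiv q)"
    by (simp only: pderiv_mult pderiv_power_Suc)
  also have "\<dots> = q ^ k * (q * pderiv r + smult (real (Suc k)) (r * pderiv q))"
    by (simp add: algebra_simps del: of_nat_Suc)
  finally show ?thesis by simp
qed

lemma power_dvd_higher_pderiv:
  fixes p q :: "real poly"
  assumes "q ^ (k + i) dvd p"
  shows "q ^ k dvd (pderiv ^^ i) p"
  using assms
proof (induction i arbitrary: k)
  case (Suc i)
  have "q ^ Suc k dvd (pderiv ^^ i) p" by (rule Suc.IH) (use Suc.prems in simp)
  then show ?case using power_dvd_pderiv by simp
qed simp

text \<open>The polynomial \<open>t ^ (2 * n) * (1 - t) ^ (2 * n + 1)\<close>. The order of its zero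
  at 0 makes the derivative of order \<open>2 * n\<close> the first one not to vanish there; at 1
  that derivative vanishes too.\<close>

definition bump :: "nat \<Rightarrow> real poly" where
  "bump n = monom 1 (2 * n) * [:1, -1:] ^ (2 * n + 1)"

definition bump_deriv :: "nat \<Rightarrow> nat \<Rightarrow> real \<Rightarrow> real" where
  "bump_deriv n i t = poly ((pderiv ^^ i) (bump n)) t"

lemma has_derivative_bump_deriv:
  "(bump_deriv n i has_real_derivative bump_deriv n (Suc i) t) (at t)"
  unfolding bump_deriv_def by (simp add: poly_DERIV)

lemma continuous_bump_deriv: "continuous_on A (bump_deriv n i)"
  unfolding bump_deriv_def by (intro continuous_intros)

lemma bump_deriv_1:
  assumes "i \<le> 2 * n" shows "bump_deriv n i 1 = 0"
proof -
  have "[:1, -1:] ^ (1 + i) dvd [:1, -1::real:] ^ (2 * n + 1)"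
    using assms by (intro le_imp_power_dvd) simp
  then have "[:1, -1:] ^ (1 + i) dvd bump n" unfolding bump_def by (rule dvd_mult)
  then have "[:1, -1:] ^ 1 dvd (pderiv ^^ i) (bump n)" by (rule power_dvd_higher_pderiv)
  then obtain r where "(pderiv ^^ i) (bump n) = [:1, -1:] * r" by (auto elim: dvdE)
  then show ?thesis by (simp add: bump_deriv_def)
qed

lemma bump_deriv_0:
  assumes "i < 2 * n" shows "bump_deriv n i 0 = 0"
proof -
  have "[:0, 1:] ^ (1 + i) dvd [:0, 1::real:] ^ (2 * n)"
    using assms by (intro le_imp_power_dvd) simp
  then have "[:0, 1:] ^ (1 + i) dvd bump n" unfolding bump_def monom_altdef by (intro dvd_mult2) simp
  then have "[:0, 1:] ^ 1 dvd (pderiv ^^ i) (bump n)" by (rule power_dvd_higher_pderiv)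
  then obtain r where "(pderiv ^^ i) (bump n) = [:0, 1:] * r" by (auto elim: dvdE)
  then show ?thesis by (simp add: bump_deriv_def)
qed

lemma bump_deriv_0_top: "bump_deriv n (2 * n) 0 = fact (2 * n)"
proof -
  have "bump_deriv n (2 * n) 0 = coeff ((pderiv ^^ (2 * n)) (bump n)) 0"
    by (simp add: bump_deriv_def poly_0_coeff_0)
  also have "\<dots> = fact (2 * n) * coeff (bump n) (2 * n)"
    by (simp add: coeff_higher_pderiv pochhammer_fact)
  also have "coeff (bump n) (2 * n) = 1"
    by (simp add: bump_def coeff_monom_mult coeff_0_power)
  finally show ?thesis by simp
qed

lemma bump_deriv_bound:
  obtains M where "M \<ge> 0" "\<And>i t. i \<le> k \<Longrightarrow> t \<in> {0..1} \<Longrightarrow> \<bar>bump_deriv n i t\<bar> \<le> M"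
proof -
  have "\<exists>M. \<forall>t\<in>{0..1}. \<bar>bump_deriv n i t\<bar> \<le> M" for i
  proof -
    have "bounded (bump_deriv n i ` {0..1})"
      by (intro compact_imp_bounded compact_continuous_image continuous_bump_deriv) auto
    then show ?thesis unfolding bounded_iff by auto
  qed
  then obtain M where M: "\<And>i t. t \<in> {0..1} \<Longrightarrow> \<bar>bump_deriv n i t\<bar> \<le> M i" by metis
  have M0: "M i \<ge> 0" for i using M[of 0 i] by (intro order_trans[OF abs_ge_zero]) auto
  show thesis
  proof (rule that[of "\<Sum>i\<le>k. M i"])
    fix i t assume "i \<le> k" "t \<in> {0..1::real}"
    then show "\<bar>bump_deriv n i t\<bar> \<le> (\<Sum>i\<le>k. M i)"
      using M[of t i] member_le_sum[of i "{..k}" M] M0 by fastforce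
  qed (use M0 in \<open>simp add: sum_nonneg\<close>)
qed

text \<open>The operator polynomial \<open>\<Prod>\<^sub>i (T - \<mu>\<^sub>i)\<close> applied to a sequence, where \<open>T\<close> is the left shift.\<close>

fun shift_poly :: "real list \<Rightarrow> (nat \<Rightarrow> 'a::real_vector) \<Rightarrow> nat \<Rightarrow> 'a" where
  "shift_poly [] f i = f i"
| "shift_poly (\<mu> # \<mu>s) f i = shift_poly \<mu>s f (Suc i) - \<mu> *\<^sub>R shift_poly \<mu>s f i"

lemma shift_poly_bound:
  assumes "\<forall>\<mu>\<in>set \<mu>s. \<bar>\<mu>\<bar> \<le> K" "K \<ge> 0" "\<And>j. j \<le> i + length \<mu>s \<Longrightarrow> norm (f j) \<le> M"
  shows "norm (shift_poly \<mu>s f i :: 'a::real_normed_vector) \<le> (1 + K) ^ length \<mu>s * M"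
  using assms
proof (induction \<mu>s arbitrary: i)
  case (Cons \<mu> \<mu>s)
  have 1: "norm (shift_poly \<mu>s f (Suc i)) \<le> (1 + K) ^ length \<mu>s * M"
    and 2: "norm (shift_poly \<mu>s f i) \<le> (1 + K) ^ length \<mu>s * M"
    using Cons.prems by (intro Cons.IH; simp)+
  have "norm (shift_poly (\<mu> # \<mu>s) f i) \<le> norm (shift_poly \<mu>s f (Suc i)) + \<bar>\<mu>\<bar> * norm (shift_poly \<mu>s f i)"
    by (simp add: norm_triangle_le_diff)
  also have "\<dots> \<le> (1 + K) ^ length \<mu>s * M + K * ((1 + K) ^ length \<mu>s * M)"
    using Cons.prems by (intro add_mono 1 mult_mono 2) auto
  finally show ?case by (simp add: algebra_simps)
qed simp

text \<open>The operator polynomial is monic, and only its leading term survives. This gives the end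
  point values of the test function.\<close>

lemma shift_poly_top:
  assumes "\<And>j. j < i + length \<mu>s \<Longrightarrow> f j = 0"
  shows "shift_poly \<mu>s f i = f (i + length \<mu>s)"
  using assms
proof (induction \<mu>s arbitrary: i)
  case (Cons \<mu> \<mu>s)
  have "shift_poly \<mu>s f (Suc i) = f (Suc i + length \<mu>s)" "shift_poly \<mu>s f i = f (i + length \<mu>s)"
    using Cons.prems by (intro Cons.IH; simp)+
  then show ?case using Cons.prems[of "i + length \<mu>s"] by simp
qed simp

lemma shift_poly_tendsto:
  fixes f :: "nat \<Rightarrow> 'a::real_normed_vector"
  assumes "\<And>j. j \<le> i + length \<mu>s \<Longrightarrow> (\<lambda>n. g n j) \<longlonglongrightarrow> f j"
  shows "(\<lambda>n. shift_poly \<mu>s (g n) i) \<longlonglongrightarrow> shift_poly \<mu>s f i"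
  using assms
proof (induction \<mu>s arbitrary: i)
  case (Cons \<mu> \<mu>s)
  have "(\<lambda>n. shift_poly \<mu>s (g n) (Suc i)) \<longlonglongrightarrow> shift_poly \<mu>s f (Suc i)" "(\<lambda>n. shift_poly \<mu>s (g n) i) \<longlonglongrightarrow> shift_poly \<mu>s f i"
    using Cons.prems by (intro Cons.IH; simp)+
  then show ?case by (auto intro!: tendsto_intros)
qed simp

lemma shift_poly_derivative:
  assumes "\<And>j. (f j has_real_derivative f' j t) (at t)"
  shows "((\<lambda>t. shift_poly \<mu>s (\<lambda>j. f j t) i) has_real_derivative shift_poly \<mu>s (\<lambda>j. f' j t) i) (at t)"
  by (induction \<mu>s arbitrary: i) (auto intro!: derivative_eq_intros assms)

lemma shift_poly_continuous:
  fixes f :: "nat \<Rightarrow> real \<Rightarrow> real"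
  assumes "\<And>j. continuous_on A (f j)"
  shows "continuous_on A (\<lambda>t. shift_poly \<mu>s (\<lambda>j. f j t) i)"
  by (induction \<mu>s arbitrary: i) (auto intro!: continuous_intros assms)

lemma shift_poly_has_integral:
  fixes u :: "real \<Rightarrow> 'a::euclidean_space"
  assumes "\<And>j. ((\<lambda>t. f j t *\<^sub>R u t) has_integral c j) A"
  shows "((\<lambda>t. shift_poly \<mu>s (\<lambda>j. f j t) i *\<^sub>R u t) has_integral shift_poly \<mu>s c i) A"
proof (induction \<mu>s arbitrary: i)
  case (Cons \<mu> \<mu>s)
  have "((\<lambda>t. shift_poly \<mu>s (\<lambda>j. f j t) (Suc i) *\<^sub>R u t - \<mu> *\<^sub>R (shift_poly \<mu>s (\<lambda>j. f j t) i *\<^sub>R u t))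
     has_integral (shift_poly \<mu>s c (Suc i) - \<mu> *\<^sub>R shift_poly \<mu>s c i)) A"
    by (intro has_integral_diff has_integral_cmul Cons.IH)
  then show ?case by (simp add: scaleR_diff_left)
qed (simp add: assms)

text \<open>On an orbit of \<open>S\<close> the left shift acts as \<open>S\<close>; since the
  factors commute with \<open>S\<close>, the order of the roots is immaterial.\<close>

lemma shift_poly_iterate:
  assumes lin: "linear S" and f: "\<And>j. j < i + length \<mu>s \<Longrightarrow> f (Suc j) = S (f j)"
  shows "shift_poly \<mu>s f i = foldr (\<lambda>\<mu> y. S y - \<mu> *\<^sub>R y) \<mu>s (f i)"
  using f
proof (induction \<mu>s arbitrary: i)
  case (Cons \<mu> \<mu>s)
  have comm: "foldr (\<lambda>\<mu> y. S y - \<mu> *\<^sub>R y) \<mu>s (S y) = S (foldr (\<lambda>\<mu> y. S y - \<mu> *\<^sub>R y) \<mu>s y)" for y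
    by (induction \<mu>s) (simp_all add: linear_diff[OF lin] linear_scale[OF lin])
  have "shift_poly \<mu>s f (Suc i) = foldr (\<lambda>\<mu> y. S y - \<mu> *\<^sub>R y) \<mu>s (f (Suc i))"
    "shift_poly \<mu>s f i = foldr (\<lambda>\<mu> y. S y - \<mu> *\<^sub>R y) \<mu>s (f i)"
    using Cons.prems by (intro Cons.IH; simp)+
  then show ?case using Cons.prems[of i] comm by simp
qed simp

section \<open>Minimizing sequences\<close>

text \<open>A crude bound from \<open>norm (u t) \<le> 1 + u t \<bullet> u t\<close>; all that
  matters later is that moments are bounded in terms of the energy.\<close>

lemma norm_moment_le:
  fixes u :: "real \<Rightarrow> 'a::euclidean_space"
  assumes u: "unit_bdd u" and \<psi>: "continuous_on {0..1} \<psi>" "\<And>t. t \<in> {0..1} \<Longrightarrow> \<bar>\<psi> t\<bar> \<le> M" "M \<ge> 0"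
  shows "norm (integral {0..1} (\<lambda>t. \<psi> t *\<^sub>R u t)) \<le> M * (1 + energy u)"
proof -
  have iu: "(\<lambda>t. u t \<bullet> u t) integrable_on {0..1}" by (intro unit_bdd_integrable unit_bdd_inner u)
  have "norm (integral {0..1} (\<lambda>t. \<psi> t *\<^sub>R u t)) \<le> integral {0..1} (\<lambda>t. M * (1 + u t \<bullet> u t))"
  proof (rule integral_norm_bound_integral)
    show "(\<lambda>t. \<psi> t *\<^sub>R u t) integrable_on {0..1}"
      by (intro unit_bdd_integrable unit_bdd_scaleR unit_bdd_continuous[OF \<psi>(1)] u)
    show "(\<lambda>t. M * (1 + u t \<bullet> u t)) integrable_on {0..1}"
      by (intro integrable_on_mult_right integrable_add iu) auto
    fix t assume t: "t \<in> {0..1::real}"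
    have "0 \<le> (norm (u t) - 1)\<^sup>2 + (norm (u t))\<^sup>2 + 1" by simp
    then have "norm (u t) \<le> 1 + u t \<bullet> u t"
      by (simp add: dot_square_norm power2_eq_square algebra_simps)
    then have "\<bar>\<psi> t\<bar> * norm (u t) \<le> M * (1 + u t \<bullet> u t)"
      using \<psi>(2)[OF t] \<psi>(3) by (intro mult_mono) auto
    then show "norm (\<psi> t *\<^sub>R u t) \<le> M * (1 + u t \<bullet> u t)" by simp
  qed
  also have "integral {0..1} (\<lambda>t. M * (1 + u t \<bullet> u t)) = M * (1 + energy u)"
  proof -
    have "integral {0..1} (\<lambda>t. 1 + u t \<bullet> u t) = integral {0..1::real} (\<lambda>t. 1) + energy u"
      unfolding energy_def by (rule integral_add[OF _ iu]) auto
    then show ?thesis by simp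
  qed
  finally show ?thesis .
qed

lemma nonneg_of_small_quadratic:
  fixes a b :: real
  assumes "\<And>s. s > 0 \<Longrightarrow> 0 \<le> 2 * s * a + s\<^sup>2 * b"
  shows "a \<ge> 0"
proof (rule ccontr)
  assume "\<not> a \<ge> 0"
  then have a: "a < 0" by simp
  define s where "s = - a / (\<bar>b\<bar> + 1)"
  have s: "s > 0" using a by (simp add: s_def divide_neg_pos add_nonneg_pos)
  have "s * b \<le> s * (\<bar>b\<bar> + 1)" using s by (intro mult_left_mono) auto
  also have "\<dots> = - a" by (simp add: s_def)
  finally have "2 * a + s * b < 0" using a by linarith
  then have "s * (2 * a + s * b) < 0" using s by (rule mult_pos_neg[rotated])
  then show False using assms[OF s] by (simp add: power2_eq_square algebra_simps)
qed

context step2_group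
begin

text \<open>First variation of the energy along \<open>s *\<^sub>R y\<close>, where \<open>y\<close>
  combines bump derivatives with vector coefficients. The perturbed curves miss \<open>p\<close> by
  a vertical error with linear part \<open>2 * s\<close> times a moment sum, and the Lipschitz bound
  converts this error into the term with \<open>C\<close>. Dividing by \<open>s\<close> removes the
  quadratic terms.\<close>

lemma minimizing_moments_condition:
  fixes w :: "nat \<Rightarrow> real ^ 'm" and u :: "nat \<Rightarrow> real \<Rightarrow> real ^ 'm"
  assumes C: "C \<ge> 0" "\<And>x z w. dsq (x, z + w) \<le> dsq (x, z) + C * norm w"
    and u: "\<And>n. steers B (u n) p" "(\<lambda>n. energy (u n)) \<longlonglongrightarrow> dsq p"
    and U: "\<And>i. i \<le> 2 * m \<Longrightarrow> (\<lambda>n. integral {0..1} (\<lambda>t. bump_deriv m i t *\<^sub>R u n t)) \<longlonglongrightarrow> U i"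
  shows "0 \<le> (\<Sum>i<2 * m. w i \<bullet> U (Suc i)) + C * norm (\<Sum>i<2 * m. B (w i) (U i))"
proof -
  let ?I = "{..<2 * m}"
  define y where "y t = (\<Sum>i\<in>?I. bump_deriv m i t *\<^sub>R w i)" for t
  define v where "v t = (\<Sum>i\<in>?I. bump_deriv m (Suc i) t *\<^sub>R w i)" for t
  define M where "M i n = integral {0..1} (\<lambda>t. bump_deriv m i t *\<^sub>R u n t)" for i n
  define a where "a n = (\<Sum>i\<in>?I. w i \<bullet> M (Suc i) n)" for n
  define b where "b n = (\<Sum>i\<in>?I. B (w i) (M i n))" for n
  define a0 where "a0 = (\<Sum>i\<in>?I. w i \<bullet> U (Suc i))"
  define b0 where "b0 = (\<Sum>i\<in>?I. B (w i) (U i))"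
  have ub: "unit_bdd (u n)" for n using u(1)[of n] by (simp add: steers_def)
  have Mi: "((\<lambda>t. bump_deriv m i t *\<^sub>R u n t) has_integral M i n) {0..1}" for i n
    unfolding M_def
    by (intro integrable_integral unit_bdd_integrable unit_bdd_scaleR unit_bdd_continuous[OF continuous_bump_deriv] ub)
  have a_lim: "a \<longlonglongrightarrow> a0"
    unfolding a_def a0_def M_def using U by (intro tendsto_sum tendsto_inner tendsto_const) auto
  have b_lim: "b \<longlonglongrightarrow> b0"
    unfolding b_def b0_def M_def using U by (intro tendsto_sum B.tendsto tendsto_const) auto
  have yd: "(y has_vector_derivative v t) (at t)" for t
    unfolding y_def[abs_def] v_def
    by (intro has_vector_derivative_sum) (auto intro!: derivative_eq_intros has_derivative_bump_deriv)
  have vc: "continuous_on {0..1} v"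
    unfolding v_def by (intro continuous_intros continuous_bump_deriv)
  \<comment> \<open>This is the reason for the range \<open>i < 2 * m\<close>: the derivative of
    order \<open>2 * m\<close> no longer vanishes at 0.\<close>
  have y01: "y 0 = 0" "y 1 = 0"
    unfolding y_def by (simp_all add: bump_deriv_0 bump_deriv_1)
  define \<beta> where "\<beta> = integral {0..1} (\<lambda>t. B (y t) (v t))"
  have yu: "integral {0..1} (\<lambda>t. B (y t) (u n t)) = b n" for n
  proof -
    have "((\<lambda>t. \<Sum>i\<in>?I. B (w i) (bump_deriv m i t *\<^sub>R u n t)) has_integral b n) {0..1}"
      unfolding b_def using has_integral_linear[OF Mi B.bounded_linear_right]
      by (intro has_integral_sum) (auto simp: o_def)
    moreover have "(\<Sum>i\<in>?I. B (w i) (bump_deriv m i t *\<^sub>R u n t)) = B (y t) (u n t)" for t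
      by (simp add: y_def B.sum_left B.scaleR_left B.scaleR_right)
    ultimately show ?thesis by (simp add: integral_unique)
  qed
  have uv: "integral {0..1} (\<lambda>t. u n t \<bullet> v t) = a n" for n
  proof -
    have "((\<lambda>t. \<Sum>i\<in>?I. w i \<bullet> (bump_deriv m (Suc i) t *\<^sub>R u n t)) has_integral a n) {0..1}"
      unfolding a_def using has_integral_linear[OF Mi bounded_linear_inner_right]
      by (intro has_integral_sum) (auto simp: o_def)
    moreover have "(\<Sum>i\<in>?I. w i \<bullet> (bump_deriv m (Suc i) t *\<^sub>R u n t)) = u n t \<bullet> v t" for t
      by (simp add: v_def inner_sum_right inner_commute)
    ultimately show ?thesis by (simp add: integral_unique)
  qed
  have "0 \<le> 2 * s * (a0 + C * norm b0) + s\<^sup>2 * (energy v + C * norm \<beta>)" if s: "s > 0" for s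
  proof -
    have "dsq p \<le> energy (u n) + 2 * s * a n + s\<^sup>2 * energy v + C * (2 * s * norm (b n) + s\<^sup>2 * norm \<beta>)" for n
    proof -
      have sd: "((\<lambda>t. s *\<^sub>R y t) has_vector_derivative s *\<^sub>R v t) (at t)" for t
        using has_vector_derivative_scaleR[OF DERIV_const[of s] yd] by simp
      have sc: "continuous_on {0..1} (\<lambda>t. s *\<^sub>R v t)" by (intro continuous_intros vc)
      define e where "e = (2 * s) *\<^sub>R b n + s\<^sup>2 *\<^sub>R \<beta>"
      have "integral {0..1} (\<lambda>t. B (s *\<^sub>R y t) (u n t)) = s *\<^sub>R b n"
        by (simp add: B.scaleR_left yu)
      moreover have "integral {0..1} (\<lambda>t. B (s *\<^sub>R y t) (s *\<^sub>R v t)) = s\<^sup>2 *\<^sub>R \<beta>"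
        by (simp add: B.scaleR_left B.scaleR_right \<beta>_def power2_eq_square)
      ultimately have "steers B (\<lambda>t. u n t + s *\<^sub>R v t) (fst p, snd p - e)"
        using steers_perturb[OF u(1)[of n] sd sc] y01 by (simp add: B.zero_right e_def algebra_simps)
      from dsq_le_energy[OF this] have "dsq (fst p, snd p - e) \<le> energy (\<lambda>t. u n t + s *\<^sub>R v t)" .
      also have "\<dots> = energy (u n) + 2 * s * a n + s\<^sup>2 * energy v"
        unfolding energy_add[OF ub unit_bdd_continuous[OF sc]]
        by (simp add: uv energy_def power2_eq_square mult.assoc)
      finally have "dsq (fst p, snd p - e) \<le> energy (u n) + 2 * s * a n + s\<^sup>2 * energy v" .
      moreover have "dsq p \<le> dsq (fst p, snd p - e) + C * norm e"
        using C(2)[of "fst p" "snd p - e" e] by simp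
      moreover have "norm e \<le> 2 * s * norm (b n) + s\<^sup>2 * norm \<beta>"
        unfolding e_def using s by (intro norm_triangle_le) simp
      then have "C * norm e \<le> C * (2 * s * norm (b n) + s\<^sup>2 * norm \<beta>)" by (rule mult_left_mono[OF _ C(1)])
      ultimately show ?thesis by linarith
    qed
    moreover have "(\<lambda>n. energy (u n) + 2 * s * a n + s\<^sup>2 * energy v + C * (2 * s * norm (b n) + s\<^sup>2 * norm \<beta>))
       \<longlonglongrightarrow> dsq p + 2 * s * a0 + s\<^sup>2 * energy v + C * (2 * s * norm b0 + s\<^sup>2 * norm \<beta>)"
      by (intro tendsto_intros u(2) a_lim b_lim)
    ultimately have "dsq p \<le> dsq p + 2 * s * a0 + s\<^sup>2 * energy v + C * (2 * s * norm b0 + s\<^sup>2 * norm \<beta>)"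
      by (intro LIMSEQ_le_const) auto
    then show ?thesis by (simp add: algebra_simps)
  qed
  from nonneg_of_small_quadratic[OF this] show ?thesis by (simp add: a0_def b0_def)
qed

text \<open>Applied to \<open>w\<close> and to its negative, the variational inequality bounds
  \<open>a w\<close> by \<open>C * norm (b w)\<close>, so \<open>a\<close> factors through
  \<open>b\<close>. The vector \<open>l\<close> is a Lagrange multiplier for the vertical
  constraint, with a bound independent of \<open>p\<close>.\<close>

lemma minimizing_moments_multiplier:
  fixes u :: "nat \<Rightarrow> real \<Rightarrow> real ^ 'm"
  assumes C: "C \<ge> 0" "\<And>x z w. dsq (x, z + w) \<le> dsq (x, z) + C * norm w"
    and u: "\<And>n. steers B (u n) p" "(\<lambda>n. energy (u n)) \<longlonglongrightarrow> dsq p"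
    and U: "\<And>i. i \<le> 2 * m \<Longrightarrow> (\<lambda>n. integral {0..1} (\<lambda>t. bump_deriv m i t *\<^sub>R u n t)) \<longlonglongrightarrow> U i"
  obtains l where "norm l \<le> C" "\<And>i x. i < 2 * m \<Longrightarrow> x \<bullet> U (Suc i) = l \<bullet> B x (U i)"
proof -
  define a where "a w = (\<Sum>i<2 * m. w i \<bullet> U (Suc i))" for w
  define b where "b w = (\<Sum>i<2 * m. B (w i) (U i))" for w
  have a_lin: "a (\<lambda>i. v i + w i) = a v + a w" "a (\<lambda>i. c *\<^sub>R w i) = c * a w" for v w c
    by (simp_all add: a_def inner_simps sum.distrib sum_distrib_left)
  have b_lin: "b (\<lambda>i. v i + w i) = b v + b w" "b (\<lambda>i. c *\<^sub>R w i) = c *\<^sub>R b w" for v w c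
    by (simp_all add: b_def B.add_left B.scaleR_left sum.distrib scaleR_sum_right)
  define G where "G = range (\<lambda>w. (b w, a w))"
  have GI: "(b w, a w) \<in> G" for w by (simp add: G_def)
  have "subspace G"
  proof (rule subspaceI)
    show "0 \<in> G" unfolding G_def
      by (rule range_eqI[of _ _ "\<lambda>i. 0"]) (simp add: a_def b_def B.zero_left zero_prod_def)
  next
    fix x y assume "x \<in> G" "y \<in> G"
    then obtain v w where "x = (b v, a v)" "y = (b w, a w)" by (auto simp: G_def)
    then have "x + y = (b (\<lambda>i. v i + w i), a (\<lambda>i. v i + w i))" by (simp add: a_lin b_lin)
    then show "x + y \<in> G" by (simp only: GI)
  next
    fix c x assume "x \<in> G"
    then obtain w where "x = (b w, a w)" by (auto simp: G_def)
    then have "c *\<^sub>R x = (b (\<lambda>i. c *\<^sub>R w i), a (\<lambda>i. c *\<^sub>R w i))" by (simp add: a_lin b_lin)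
    then show "c *\<^sub>R x \<in> G" by (simp only: GI)
  qed
  moreover have "\<bar>a'\<bar> \<le> C * norm b'" if "(b', a') \<in> G" for b' a'
  proof -
    obtain w where w: "b' = b w" "a' = a w" using \<open>(b', a') \<in> G\<close> by (auto simp: G_def)
    have "0 \<le> a w + C * norm (b w)"
      unfolding a_def b_def by (rule minimizing_moments_condition[OF C u U])
    moreover have "0 \<le> a (\<lambda>i. (- 1) *\<^sub>R w i) + C * norm (b (\<lambda>i. (- 1) *\<^sub>R w i))"
      unfolding a_def b_def by (rule minimizing_moments_condition[OF C u U])
    then have "0 \<le> - a w + C * norm (b w)" unfolding a_lin b_lin by simp
    ultimately show ?thesis unfolding w by linarith
  qed
  ultimately obtain l where l: "norm l \<le> C" "\<And>b a. (b, a) \<in> G \<Longrightarrow> a = l \<bullet> b"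
    using bounded_graph_functional[of G C] C(1) by blast
  have "x \<bullet> U (Suc i) = l \<bullet> B x (U i)" if i: "i < 2 * m" for i x
  proof -
    \<comment> \<open>A family concentrated at one index isolates the relation between two
      consecutive moments.\<close>
    define w where "w j = (if j = i then x else 0)" for j
    have "a w = (\<Sum>j<2 * m. if j = i then x \<bullet> U (Suc i) else 0)"
      unfolding a_def w_def by (intro sum.cong) auto
    then have "a w = x \<bullet> U (Suc i)" using i by simp
    moreover have "b w = (\<Sum>j<2 * m. if j = i then B x (U i) else 0)"
      unfolding b_def w_def by (intro sum.cong) (auto simp: B.zero_left)
    then have "b w = B x (U i)" using i by simp
    moreover have "a w = l \<bullet> b w" by (rule l(2)) (simp add: G_def)
    ultimately show ?thesis by simp
  qed
  with l(1) show thesis by (rule that)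
qed

lemma dsq_minimizing_sequence:
  obtains u :: "nat \<Rightarrow> real \<Rightarrow> real ^ 'm"
  where "\<And>n. steers B (u n) p" "\<And>n. energy (u n) \<le> dsq p + 1" "(\<lambda>n. energy (u n)) \<longlonglongrightarrow> dsq p"
proof -
  have "\<exists>u. \<forall>n::nat. steers B (u n) p \<and> energy (u n) < dsq p + 1 / real (Suc n)"
    by (intro choice allI dsq_approx) simp
  then obtain u where u: "\<And>n. steers B (u n) p" "\<And>n. energy (u n) < dsq p + 1 / real (Suc n)"
    by blast
  have "(\<lambda>n. energy (u n)) \<longlonglongrightarrow> dsq p"
  proof (rule tendsto_sandwich[of "\<lambda>_. dsq p" _ _ "\<lambda>n. dsq p + 1 / real (Suc n)"])
    show "(\<lambda>n. dsq p + 1 / real (Suc n)) \<longlonglongrightarrow> dsq p"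
      using LIMSEQ_inverse_real_of_nat_add[of "dsq p"] by (simp add: inverse_eq_divide)
    show "\<forall>\<^sub>F n in sequentially. dsq p \<le> energy (u n)"
      by (intro always_eventually allI dsq_le_energy u)
    show "\<forall>\<^sub>F n in sequentially. energy (u n) \<le> dsq p + 1 / real (Suc n)"
      by (intro always_eventually allI less_imp_le u)
  qed simp
  moreover have "energy (u n) \<le> dsq p + 1" for n
  proof -
    have "1 / real (Suc n) \<le> 1" by simp
    then show ?thesis using u(2)[of n] by linarith
  qed
  ultimately show thesis using u(1) by (intro that)
qed

text \<open>The function \<phi> depends on \<open>p\<close> through the multiplier and the roots,
  but the bound on its derivative is built only from the Lipschitz constant, the norm bound of
  \<open>B\<close> and the fixed bump. This uniformity is what yields one semiconcavity constant for
  the whole group.\<close>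

lemma minimizing_test_function:
  obtains C where "C \<ge> 0"
    "\<And>p. \<exists>(\<phi>::real \<Rightarrow> real) \<phi>' u. (\<forall>n::nat. steers B (u n) p) \<and> (\<lambda>n. energy (u n)) \<longlonglongrightarrow> dsq p \<and>
      (\<forall>t. (\<phi> has_real_derivative \<phi>' t) (at t)) \<and> continuous_on {0..1} \<phi>' \<and> \<phi> 0 = 1 \<and> \<phi> 1 = 0 \<and>
      (\<forall>t\<in>{0..1}. \<bar>\<phi>' t\<bar> \<le> C) \<and> (\<lambda>n. integral {0..1} (\<lambda>t. \<phi> t *\<^sub>R u n t)) \<longlonglongrightarrow> 0"
proof -
  obtain C where C: "C \<ge> 0" "\<And>x z w. dsq (x, z + w) \<le> dsq (x, z) + C * norm w"
    using dsq_vertical by blast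
  obtain K where K: "K \<ge> 0" "\<And>x y. norm (B x y) \<le> norm x * norm y * K"
    using B.nonneg_bounded by blast
  define m where "m = CARD('m)"
  \<comment> \<open>Order \<open>2 * m + 1\<close> occurs in \<phi>', since \<phi> combines
    derivatives up to order \<open>2 * m\<close>.\<close>
  obtain M where M: "M \<ge> 0" "\<And>i t. i \<le> 2 * m + 1 \<Longrightarrow> t \<in> {0..1} \<Longrightarrow> \<bar>bump_deriv m i t\<bar> \<le> M"
    using bump_deriv_bound by blast
  \<comment> \<open>There are \<open>m\<close> factors, each enlarging a bound by at most
    \<open>1 + (C * K)\<^sup>2\<close>.\<close>
  define D where "D = (1 + (C * K)\<^sup>2) ^ m * M"
  have D0: "D \<ge> 0" using M by (simp add: D_def)
  show thesis
  proof (rule that[of D, OF D0])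
    fix p :: "('m, 'k) cpt"
    obtain u0 where u0: "\<And>n. steers B (u0 n) p" "\<And>n. energy (u0 n) \<le> dsq p + 1"
      and e0: "(\<lambda>n. energy (u0 n)) \<longlonglongrightarrow> dsq p"
      by (rule dsq_minimizing_sequence[of p]) (rule that)
    define mom where "mom i n = integral {0..1} (\<lambda>t. bump_deriv m i t *\<^sub>R u0 n t)" for i n
    have "bounded (range (mom i))" if i: "i < 2 * m + 1" for i
    proof (rule boundedI)
      fix x assume "x \<in> range (mom i)"
      then obtain n where x: "x = mom i n" by blast
      have "norm x \<le> M * (1 + energy (u0 n))"
        unfolding x mom_def using u0(1)[of n] i M
        by (intro norm_moment_le continuous_bump_deriv) (auto simp: steers_def)
      also have "\<dots> \<le> M * (1 + (dsq p + 1))" using M(1) u0(2)[of n] by (intro mult_left_mono) auto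
      finally show "norm x \<le> M * (1 + (dsq p + 1))" .
    qed
    then obtain r U where r: "strict_mono r" "\<And>i. i < 2 * m + 1 \<Longrightarrow> (\<lambda>n. mom i (r n)) \<longlonglongrightarrow> U i"
      using finite_family_convergent_subsequence[of "2 * m + 1" mom] by blast
    define u where "u n = u0 (r n)" for n
    have u: "\<And>n. steers B (u n) p" using u0 by (simp add: u_def)
    have ue: "(\<lambda>n. energy (u n)) \<longlonglongrightarrow> dsq p"
      unfolding u_def using LIMSEQ_subseq_LIMSEQ[OF e0 r(1)] by (simp add: o_def)
    have U: "(\<lambda>n. integral {0..1} (\<lambda>t. bump_deriv m i t *\<^sub>R u n t)) \<longlonglongrightarrow> U i" if "i \<le> 2 * m" for i
      using r(2)[of i] that by (simp add: u_def mom_def)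
    obtain l where l: "norm l \<le> C" "\<And>i x. i < 2 * m \<Longrightarrow> x \<bullet> U (Suc i) = l \<bullet> B x (U i)"
      using minimizing_moments_multiplier[OF C u ue U] by blast
    \<comment> \<open>The operator representing the bilinear form \<open>l \<bullet> B x y\<close>;
      it inherits skewness from \<open>B\<close> and turns the multiplier relation into a recursion
      for the moments.\<close>
    define A where "A y = (\<Sum>i\<in>Basis. (l \<bullet> B i y) *\<^sub>R i)" for y
    have A: "x \<bullet> A y = l \<bullet> B x y" for x y
    proof -
      have "x \<bullet> A y = (\<Sum>i\<in>Basis. (x \<bullet> i) * (l \<bullet> B i y))"
        by (simp add: A_def inner_sum_right mult.commute)
      also have "\<dots> = l \<bullet> B (\<Sum>i\<in>Basis. (x \<bullet> i) *\<^sub>R i) y"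
        by (simp add: B.sum_left B.scaleR_left inner_sum_right)
      finally show ?thesis by (simp add: euclidean_representation)
    qed
    have A_lin: "linear A"
      by (rule linearI) (simp_all add: A_def B.add_right B.scaleR_right inner_simps scaleR_add_left sum.distrib scaleR_sum_right)
    have A_skew: "A x \<bullet> y = - (x \<bullet> A y)" for x y
    proof -
      have "A x \<bullet> y = l \<bullet> B y x" by (simp add: A inner_commute[of "A x"])
      also have "\<dots> = - (x \<bullet> A y)" unfolding A using skew[of y x] by simp
      finally show ?thesis .
    qed
    have A_bd: "norm (A y) \<le> C * K * norm y" for y
    proof (cases "A y = 0")
      case True
      then show ?thesis using C K by simp
    next
      case False
      have "norm (A y) * norm (A y) = l \<bullet> B (A y) y" using A[of "A y" y] by (simp add: dot_square_norm power2_eq_square)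
      also have "\<dots> \<le> norm l * norm (B (A y) y)" by (rule norm_cauchy_schwarz)
      also have "\<dots> \<le> C * (norm (A y) * norm y * K)" by (intro mult_mono l K C) auto
      finally have "norm (A y) * norm (A y) \<le> norm (A y) * (C * K * norm y)" by (simp add: mult_ac)
      then show ?thesis using False by simp
    qed
    have UA: "U (Suc i) = A (U i)" if "i < 2 * m" for i
      by (rule vector_eq_rdot[THEN iffD1]) (use l(2)[OF that] A in \<open>simp add: inner_commute\<close>)
    \<comment> \<open>Squaring makes the operator symmetric, hence annihilated by real linear
      factors; this is why \<phi> uses only bump derivatives of even order.\<close>
    define S where "S y = A (A y)" for y
    have S_lin: "linear S" unfolding S_def using linear_compose[OF A_lin A_lin] by (simp add: o_def)
    have S_sym: "S x \<bullet> y = x \<bullet> S y" for x y by (simp add: S_def A_skew)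
    have S_bd: "norm (S y) \<le> (C * K)\<^sup>2 * norm y" for y
    proof -
      have "norm (S y) \<le> C * K * norm (A y)" unfolding S_def by (rule A_bd)
      also have "\<dots> \<le> C * K * (C * K * norm y)" using C K by (intro mult_left_mono A_bd) auto
      finally show ?thesis by (simp add: power2_eq_square mult_ac)
    qed
    obtain \<mu>s where \<mu>s: "length \<mu>s = DIM(real ^ 'm)" "\<forall>\<mu>\<in>set \<mu>s. \<bar>\<mu>\<bar> \<le> (C * K)\<^sup>2"
      "\<And>x. foldr (\<lambda>\<mu> y. S y - \<mu> *\<^sub>R y) \<mu>s x = 0"
      using selfadjoint_annihilator[OF S_lin S_sym S_bd] by auto
    have len: "length \<mu>s = m" using \<mu>s(1) by (simp add: m_def)
    \<comment> \<open>The value at 0 of the leading derivative, by which \<phi> is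
      normalized.\<close>
    define F :: real where "F = fact (2 * m)"
    have F: "F \<ge> 1" unfolding F_def by (rule fact_ge_1)
    define \<phi> where "\<phi> t = shift_poly \<mu>s (\<lambda>j. bump_deriv m (2 * j) t) 0 / F" for t
    define \<phi>' where "\<phi>' t = shift_poly \<mu>s (\<lambda>j. bump_deriv m (2 * j + 1) t) 0 / F" for t
    have \<phi>d: "(\<phi> has_real_derivative \<phi>' t) (at t)" for t
      unfolding \<phi>_def[abs_def] \<phi>'_def
      by (intro DERIV_cdivide shift_poly_derivative) (use has_derivative_bump_deriv in simp)
    have \<phi>'c: "continuous_on {0..1} \<phi>'"
      unfolding \<phi>'_def using F by (intro continuous_intros shift_poly_continuous continuous_bump_deriv) auto
    have \<phi>0: "\<phi> 0 = 1"
      using F unfolding \<phi>_def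
      by (subst shift_poly_top) (auto simp: len bump_deriv_0 bump_deriv_0_top F_def)
    have \<phi>1: "\<phi> 1 = 0"
      unfolding \<phi>_def by (subst shift_poly_top) (auto simp: len bump_deriv_1)
    have \<phi>'b: "\<bar>\<phi>' t\<bar> \<le> D" if t: "t \<in> {0..1}" for t
    proof -
      have "norm (shift_poly \<mu>s (\<lambda>j. bump_deriv m (2 * j + 1) t) 0) \<le> (1 + (C * K)\<^sup>2) ^ length \<mu>s * M"
        by (rule shift_poly_bound[OF \<mu>s(2)]) (use M(2) t len in auto)
      then have "\<bar>shift_poly \<mu>s (\<lambda>j. bump_deriv m (2 * j + 1) t) 0\<bar> \<le> D" by (simp add: D_def len)
      moreover have "D \<le> D * F" using D0 F mult_left_mono[of 1 F D] by simp
      ultimately show ?thesis using F by (simp add: \<phi>'_def abs_divide divide_le_eq)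
    qed
    have "(\<lambda>n. integral {0..1} (\<lambda>t. \<phi> t *\<^sub>R u n t)) \<longlonglongrightarrow> 0"
    proof -
      have mi: "((\<lambda>t. bump_deriv m i t *\<^sub>R u n t) has_integral integral {0..1} (\<lambda>t. bump_deriv m i t *\<^sub>R u n t)) {0..1}" for i n
        using u[of n] unfolding steers_def
        by (intro integrable_integral unit_bdd_integrable unit_bdd_scaleR unit_bdd_continuous[OF continuous_bump_deriv]) auto
      have "integral {0..1} (\<lambda>t. \<phi> t *\<^sub>R u n t) =
        (1 / F) *\<^sub>R shift_poly \<mu>s (\<lambda>j. integral {0..1} (\<lambda>t. bump_deriv m (2 * j) t *\<^sub>R u n t)) 0" for n
      proof -
        have "((\<lambda>t. (1 / F) *\<^sub>R (shift_poly \<mu>s (\<lambda>j. bump_deriv m (2 * j) t) 0 *\<^sub>R u n t)) has_integral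
          (1 / F) *\<^sub>R shift_poly \<mu>s (\<lambda>j. integral {0..1} (\<lambda>t. bump_deriv m (2 * j) t *\<^sub>R u n t)) 0) {0..1}"
          by (intro has_integral_cmul shift_poly_has_integral mi)
        then show ?thesis by (simp add: \<phi>_def integral_unique)
      qed
      moreover have "(\<lambda>n. (1 / F) *\<^sub>R shift_poly \<mu>s (\<lambda>j. integral {0..1} (\<lambda>t. bump_deriv m (2 * j) t *\<^sub>R u n t)) 0)
          \<longlonglongrightarrow> (1 / F) *\<^sub>R shift_poly \<mu>s (\<lambda>j. U (2 * j)) 0"
        by (intro tendsto_scaleR tendsto_const shift_poly_tendsto U) (simp add: len)
      \<comment> \<open>The even moments form an orbit of \<open>S\<close>, which the product of the
        factors annihilates.\<close>
      moreover have "shift_poly \<mu>s (\<lambda>j. U (2 * j)) 0 = 0"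
        using shift_poly_iterate[OF S_lin, of 0 \<mu>s "\<lambda>j. U (2 * j)"] \<mu>s(3) UA len by (simp add: S_def)
      ultimately show ?thesis by simp
    qed
    then show "\<exists>(\<phi>::real \<Rightarrow> real) \<phi>' u. (\<forall>n::nat. steers B (u n) p) \<and> (\<lambda>n. energy (u n)) \<longlonglongrightarrow> dsq p \<and>
      (\<forall>t. (\<phi> has_real_derivative \<phi>' t) (at t)) \<and> continuous_on {0..1} \<phi>' \<and> \<phi> 0 = 1 \<and> \<phi> 1 = 0 \<and>
      (\<forall>t\<in>{0..1}. \<bar>\<phi>' t\<bar> \<le> D) \<and> (\<lambda>n. integral {0..1} (\<lambda>t. \<phi> t *\<^sub>R u n t)) \<longlonglongrightarrow> 0"
      by (intro exI[of _ \<phi>] exI[of _ \<phi>'] exI[of _ u] conjI allI ballI u ue \<phi>d \<phi>'c \<phi>0 \<phi>1 \<phi>'b)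
  qed
qed

section \<open>Semiconcavity\<close>

text \<open>Along the minimizing sequence the vertical error is a multiple of
  \<open>B h (w n)\<close>, which tends to 0. Correcting it costs a multiple of \<open>L\<close>
  that disappears in the limit, so only the bound on \<phi>' enters the constant.\<close>

lemma dsq_second_difference:
  obtains C where "C \<ge> 0"
    "\<And>x z h. dsq (x + h, z + B x h) + dsq (x - h, z - B x h) - 2 * dsq (x, z) \<le> C * (norm h)\<^sup>2"
proof -
  obtain L where L: "L \<ge> 0" "\<And>x z w. dsq (x, z + w) \<le> dsq (x, z) + L * norm w"
    using dsq_vertical by blast
  obtain C where C: "C \<ge> 0"
    "\<And>p. \<exists>(\<phi>::real \<Rightarrow> real) \<phi>' u. (\<forall>n::nat. steers B (u n) p) \<and> (\<lambda>n. energy (u n)) \<longlonglongrightarrow> dsq p \<and>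
      (\<forall>t. (\<phi> has_real_derivative \<phi>' t) (at t)) \<and> continuous_on {0..1} \<phi>' \<and> \<phi> 0 = 1 \<and> \<phi> 1 = 0 \<and>
      (\<forall>t\<in>{0..1}. \<bar>\<phi>' t\<bar> \<le> C) \<and> (\<lambda>n. integral {0..1} (\<lambda>t. \<phi> t *\<^sub>R u n t)) \<longlonglongrightarrow> 0"
    using minimizing_test_function by blast
  show thesis
  proof (rule that[of "2 * C\<^sup>2"])
    fix x h :: "real ^ 'm" and z :: "real ^ 'k"
    obtain \<phi> :: "real \<Rightarrow> real" and \<phi>' u where u: "\<And>n::nat. steers B (u n) (x, z)" "(\<lambda>n. energy (u n)) \<longlonglongrightarrow> dsq (x, z)"
      and \<phi>: "\<And>t. (\<phi> has_real_derivative \<phi>' t) (at t)" "continuous_on {0..1} \<phi>'" "\<phi> 0 = 1" "\<phi> 1 = 0"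
        "\<And>t. t \<in> {0..1} \<Longrightarrow> \<bar>\<phi>' t\<bar> \<le> C" "(\<lambda>n. integral {0..1} (\<lambda>t. \<phi> t *\<^sub>R u n t)) \<longlonglongrightarrow> 0"
      using C(2)[of "(x, z)"] by blast
    have \<phi>c: "continuous_on {0..1} \<phi>" using \<phi>(1) by (intro DERIV_continuous_on) (auto intro: DERIV_subset)
    define w where "w n = integral {0..1} (\<lambda>t. \<phi> t *\<^sub>R u n t)" for n
    define J where "J n = integral {0..1} (\<lambda>t. u n t \<bullet> (\<phi>' t *\<^sub>R h))" for n
    have ub: "unit_bdd (u n)" for n using u(1)[of n] by (simp add: steers_def)
    have w: "((\<lambda>t. \<phi> t *\<^sub>R u n t) has_integral w n) {0..1}" for n
      unfolding w_def by (intro integrable_integral unit_bdd_integrable unit_bdd_scaleR unit_bdd_continuous[OF \<phi>c] ub)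
    have key: "dsq (x + s *\<^sub>R h, z + s *\<^sub>R B x h) \<le> energy (u n) + 2 * s * J n + C\<^sup>2 * (norm h)\<^sup>2 + L * (2 * norm (B h (w n)))"
      if s: "\<bar>s\<bar> = 1" for s n
    proof -
      define v where "v t = \<phi>' t *\<^sub>R (s *\<^sub>R h)" for t
      have yd: "((\<lambda>t. \<phi> t *\<^sub>R (s *\<^sub>R h)) has_vector_derivative v t) (at t)" for t
        using has_vector_derivative_scaleR[OF \<phi>(1) has_vector_derivative_const[of "s *\<^sub>R h"]] by (simp add: v_def)
      have vc: "continuous_on {0..1} v" unfolding v_def by (intro continuous_intros \<phi>(2))
      have "((\<lambda>t. s *\<^sub>R B h (\<phi> t *\<^sub>R u n t)) has_integral s *\<^sub>R B h (w n)) {0..1}"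
        using has_integral_linear[OF w B.bounded_linear_right[of h]] by (intro has_integral_cmul) (simp add: o_def)
      then have 1: "integral {0..1} (\<lambda>t. B (\<phi> t *\<^sub>R (s *\<^sub>R h)) (u n t)) = s *\<^sub>R B h (w n)"
        by (simp add: B.scaleR_left B.scaleR_right integral_unique mult.commute)
      \<comment> \<open>Both arguments are multiples of \<open>h\<close>, so there is no quadratic
        vertical error.\<close>
      have 2: "B (\<phi> t *\<^sub>R (s *\<^sub>R h)) (v t) = 0" for t
        by (simp add: v_def B.scaleR_left B.scaleR_right)
      define e where "e = (2 * s) *\<^sub>R B h (w n)"
      have "steers B (\<lambda>t. u n t + v t) (x + s *\<^sub>R h, z + s *\<^sub>R B x h - e)"
        using steers_perturb[OF u(1)[of n] yd vc] \<phi>(3,4) unfolding 1 2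
        by (simp add: B.scaleR_right e_def)
      from dsq_le_energy[OF this]
      have "dsq (x + s *\<^sub>R h, z + s *\<^sub>R B x h - e) \<le> energy (u n) + 2 * (s * J n) + energy v"
        unfolding energy_add[OF ub unit_bdd_continuous[OF vc]] by (simp add: J_def v_def mult_ac)
      moreover have "energy v \<le> C\<^sup>2 * (norm h)\<^sup>2"
      proof -
        have "energy v \<le> integral {0..1::real} (\<lambda>t. C\<^sup>2 * (norm h)\<^sup>2)"
          unfolding energy_def
        proof (rule integral_le)
          show "(\<lambda>t. v t \<bullet> v t) integrable_on {0..1}" by (intro integrable_continuous_real continuous_intros vc)
          fix t assume t: "t \<in> {0..1::real}"
          have "norm (v t) \<le> C * norm h"
            using \<phi>(5)[OF t] s by (simp add: v_def abs_mult mult_right_mono)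
          then have "(norm (v t))\<^sup>2 \<le> (C * norm h)\<^sup>2" by (rule power_mono) simp
          then show "v t \<bullet> v t \<le> C\<^sup>2 * (norm h)\<^sup>2" by (simp add: dot_square_norm power_mult_distrib)
        qed auto
        then show ?thesis by simp
      qed
      moreover have "dsq (x + s *\<^sub>R h, z + s *\<^sub>R B x h) \<le> dsq (x + s *\<^sub>R h, z + s *\<^sub>R B x h - e) + L * norm e"
        using L(2)[of "x + s *\<^sub>R h" "z + s *\<^sub>R B x h - e" e] by simp
      moreover have "norm e = 2 * norm (B h (w n))" using s by (simp add: e_def abs_mult)
      ultimately show ?thesis by simp
    qed
    \<comment> \<open>The first-order energy terms \<open>J n\<close> of the two signs
      cancel.\<close>
    have "dsq (x + h, z + B x h) + dsq (x - h, z - B x h)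
      \<le> 2 * energy (u n) + 2 * C\<^sup>2 * (norm h)\<^sup>2 + 4 * L * norm (B h (w n))" for n
      using key[of 1 n] key[of "- 1" n] by simp
    moreover have "(\<lambda>n. 2 * energy (u n) + 2 * C\<^sup>2 * (norm h)\<^sup>2 + 4 * L * norm (B h (w n)))
       \<longlonglongrightarrow> 2 * dsq (x, z) + 2 * C\<^sup>2 * (norm h)\<^sup>2 + 4 * L * norm (B h 0)"
      using \<phi>(6) by (intro tendsto_intros u(2) B.tendsto) (simp add: w_def[abs_def])
    ultimately have "dsq (x + h, z + B x h) + dsq (x - h, z - B x h)
        \<le> 2 * dsq (x, z) + 2 * C\<^sup>2 * (norm h)\<^sup>2 + 4 * L * norm (B h 0)"
      by (intro LIMSEQ_le_const) auto
    then show "dsq (x + h, z + B x h) + dsq (x - h, z - B x h) - 2 * dsq (x, z) \<le> 2 * C\<^sup>2 * (norm h)\<^sup>2"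
      by (simp add: B.zero_right)
  qed simp
qed

section \<open>Lower semicontinuity of the squared distance\<close>

text \<open>The affine perturbation \<open>(1 - t) *\<^sub>R h\<close> carries the starting point
  over \<open>y\<close>, and a vertical shift does the rest. The estimate involves the squared
  distance only at \<open>(x, z)\<close>, so it can be used without prior continuity.\<close>

lemma dsq_move:
  obtains L K where "L \<ge> 0" "K \<ge> 0"
    "\<And>x z y w. dsq (y, w) \<le> dsq (x, z) + 2 * norm (y - x) * (1 + dsq (x, z)) + (norm (y - x))\<^sup>2
       + L * (norm (w - z - B x (y - x)) + 2 * K * norm (y - x) * (1 + dsq (x, z)))"
proof -
  obtain L where L: "L \<ge> 0" "\<And>x z w. dsq (x, z + w) \<le> dsq (x, z) + L * norm w"
    using dsq_vertical by blast
  obtain K where K: "K \<ge> 0" "\<And>x y. norm (B x y) \<le> norm x * norm y * K"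
    using B.nonneg_bounded by blast
  show thesis
  proof (rule that[OF L(1) K(1)])
    fix x y :: "real ^ 'm" and z w :: "real ^ 'k"
    define h where "h = y - x"
    \<comment> \<open>A continuous function of the energy, so the estimate for single controls
      passes to the limit along a minimizing sequence.\<close>
    define rhs where "rhs E = E + 2 * norm h * (1 + E) + (norm h)\<^sup>2
       + L * (norm (w - z - B x h) + 2 * K * norm h * (1 + E))" for E
    have st: "dsq (y, w) \<le> rhs (energy u)" if u: "steers B u (x, z)" for u
    proof -
      have ub: "unit_bdd u" using u by (simp add: steers_def)
      have yd: "((\<lambda>t. (1 - t) *\<^sub>R h) has_vector_derivative (- 1) *\<^sub>R h) (at t)" for t
        by (auto intro!: derivative_eq_intros)
      define q where "q = integral {0..1} (\<lambda>t. (1 - t) *\<^sub>R u t)"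
      have "((\<lambda>t. (1 - t) *\<^sub>R u t) has_integral q) {0..1}"
        unfolding q_def
        by (intro integrable_integral unit_bdd_integrable unit_bdd_scaleR unit_bdd_continuous ub continuous_intros)
      from has_integral_linear[OF this B.bounded_linear_right[of h]]
      have 1: "integral {0..1} (\<lambda>t. B ((1 - t) *\<^sub>R h) (u t)) = B h q"
        by (simp add: o_def B.scaleR_left B.scaleR_right integral_unique)
      have 2: "B ((1 - t) *\<^sub>R h) ((- 1) *\<^sub>R h) = 0" for t
        by (simp add: B.scaleR_left B.minus_right)
      have qn: "norm q \<le> 1 * (1 + energy u)"
        unfolding q_def by (rule norm_moment_le[OF ub]) (auto intro!: continuous_intros)
      define j where "j = integral {0..1} (\<lambda>t. 1 *\<^sub>R u t)"
      have jn: "norm j \<le> 1 * (1 + energy u)"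
        unfolding j_def by (rule norm_moment_le[OF ub]) auto
      have "steers B (\<lambda>t. u t + (- 1) *\<^sub>R h) (y, z + B x h - 2 *\<^sub>R B h q)"
        using steers_perturb[OF u yd] unfolding 1 2 by (simp add: h_def)
      from dsq_le_energy[OF this]
      have d1: "dsq (y, z + B x h - 2 *\<^sub>R B h q) \<le> energy u + 2 * integral {0..1} (\<lambda>t. u t \<bullet> ((- 1) *\<^sub>R h)) + energy (\<lambda>t::real. (- 1) *\<^sub>R h)"
        by (subst (asm) energy_add[OF ub unit_bdd_continuous]) auto
      have "((\<lambda>t. 1 *\<^sub>R u t) has_integral j) {0..1}"
        unfolding j_def by (intro integrable_integral unit_bdd_integrable unit_bdd_scaleR unit_bdd_continuous ub continuous_intros)
      from has_integral_linear[OF this bounded_linear_inner_left[of "(- 1) *\<^sub>R h"]]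
      have "integral {0..1} (\<lambda>t. u t \<bullet> ((- 1) *\<^sub>R h)) = j \<bullet> ((- 1) *\<^sub>R h)"
        by (simp only: o_def scaleR_one integral_unique)
      also have "\<dots> \<le> norm j * norm h" using norm_cauchy_schwarz[of j "- h"] by simp
      also have "\<dots> \<le> (1 + energy u) * norm h" using jn by (intro mult_right_mono) auto
      finally have d2: "integral {0..1} (\<lambda>t. u t \<bullet> ((- 1) *\<^sub>R h)) \<le> norm h * (1 + energy u)" by (simp add: mult.commute)
      have d3: "energy (\<lambda>t::real. (- 1) *\<^sub>R h) = (norm h)\<^sup>2" by (simp add: energy_def dot_square_norm)
      \<comment> \<open>The vertical gap left between the point reached and
        \<open>(y, w)\<close>.\<close>
      define e where "e = w - z - B x h + 2 *\<^sub>R B h q"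
      have d4: "dsq (y, w) \<le> dsq (y, z + B x h - 2 *\<^sub>R B h q) + L * norm e"
        using L(2)[of y "z + B x h - 2 *\<^sub>R B h q" e] by (simp add: e_def)
      have "norm (B h q) \<le> norm h * norm q * K" by (rule K(2))
      also have "\<dots> \<le> norm h * (1 + energy u) * K" using qn K(1) by (intro mult_right_mono mult_left_mono) auto
      finally have "norm (2 *\<^sub>R B h q) \<le> 2 * K * norm h * (1 + energy u)" by (simp add: algebra_simps)
      then have "norm e \<le> norm (w - z - B x h) + 2 * K * norm h * (1 + energy u)"
        unfolding e_def by (intro norm_triangle_le) simp
      then have "L * norm e \<le> L * (norm (w - z - B x h) + 2 * K * norm h * (1 + energy u))"
        by (rule mult_left_mono[OF _ L(1)])
      moreover have "2 * norm h * (1 + energy u) = 2 * (norm h * (1 + energy u))" by (rule mult.assoc)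
      ultimately show ?thesis unfolding rhs_def using d1 d2 d4 unfolding d3 by linarith
    qed
    obtain u where u: "\<And>n. steers B (u n) (x, z)" "(\<lambda>n. energy (u n)) \<longlonglongrightarrow> dsq (x, z)"
      by (rule dsq_minimizing_sequence[of "(x, z)"]) (rule that)
    have "(\<lambda>n. rhs (energy (u n))) \<longlonglongrightarrow> rhs (dsq (x, z))"
      unfolding rhs_def by (intro tendsto_intros u(2))
    then have "dsq (y, w) \<le> rhs (dsq (x, z))"
      using st[OF u(1)] by (intro LIMSEQ_le_const) auto
    then show "dsq (y, w) \<le> dsq (x, z) + 2 * norm (y - x) * (1 + dsq (x, z)) + (norm (y - x))\<^sup>2
       + L * (norm (w - z - B x (y - x)) + 2 * K * norm (y - x) * (1 + dsq (x, z)))"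
      by (simp add: rhs_def h_def)
  qed
qed

text \<open>The move goes from the nearby point \<open>q\<close> to \<open>p\<close>: if
  \<open>dsq q\<close> were at most \<open>c\<close>, then \<open>dsq p\<close> would exceed
  \<open>c\<close> by at most a quantity that tends to 0 as \<open>q\<close> approaches
  \<open>p\<close>.\<close>

lemma lsc_dsq: "lsc_on UNIV dsq"
  unfolding lsc_on_def
proof (intro ballI allI impI)
  fix p c assume c: "c < dsq p"
  obtain L K where L: "L \<ge> 0" "K \<ge> 0" and
    move: "\<And>x z y w. dsq (y, w) \<le> dsq (x, z) + 2 * norm (y - x) * (1 + dsq (x, z)) + (norm (y - x))\<^sup>2
       + L * (norm (w - z - B x (y - x)) + 2 * K * norm (y - x) * (1 + dsq (x, z)))"
    using dsq_move by blast
  \<comment> \<open>The increment in \<open>dsq_move\<close> with \<open>dsq q\<close> replaced by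
    the threshold \<open>c\<close>, which makes it visibly continuous in \<open>q\<close>; the
    replacement is justified by monotonicity when \<open>dsq q \<le> c\<close>.\<close>
  define \<rho> where "\<rho> q = 2 * norm (fst p - fst q) * (1 + c) + (norm (fst p - fst q))\<^sup>2
       + L * (norm (snd p - snd q - B (fst q) (fst p - fst q)) + 2 * K * norm (fst p - fst q) * (1 + c))" for q
  have "(\<rho> \<longlongrightarrow> 2 * norm (fst p - fst p) * (1 + c) + (norm (fst p - fst p))\<^sup>2
       + L * (norm (snd p - snd p - B (fst p) (fst p - fst p)) + 2 * K * norm (fst p - fst p) * (1 + c))) (at p)"
    unfolding \<rho>_def by (intro tendsto_intros B.tendsto)
  then have "(\<rho> \<longlongrightarrow> 0) (at p)" by (simp add: B.zero_right)
  then have "eventually (\<lambda>q. \<rho> q < dsq p - c) (at p)"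
    using c by (intro order_tendstoD(2)) auto
  then show "eventually (\<lambda>q. c < dsq q) (at p within UNIV)"
  proof (rule eventually_mono)
    fix q assume q: "\<rho> q < dsq p - c"
    show "c < dsq q"
    proof (rule ccontr)
      assume "\<not> c < dsq q"
      then have le: "dsq q \<le> c" by simp
      have "dsq p \<le> dsq q + 2 * norm (fst p - fst q) * (1 + dsq q) + (norm (fst p - fst q))\<^sup>2
       + L * (norm (snd p - snd q - B (fst q) (fst p - fst q)) + 2 * K * norm (fst p - fst q) * (1 + dsq q))"
        using move[of "fst p" "snd p" "fst q" "snd q"] by simp
      also have "\<dots> \<le> c + 2 * norm (fst p - fst q) * (1 + c) + (norm (fst p - fst q))\<^sup>2
       + L * (norm (snd p - snd q - B (fst q) (fst p - fst q)) + 2 * K * norm (fst p - fst q) * (1 + c))"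
        using le L by (intro add_mono mult_left_mono order_refl) auto
      finally show False using q by (simp add: \<rho>_def)
    qed
  qed
qed

lemma h_semiconcave_dsq: "h_semiconcave B UNIV dsq"
proof -
  obtain C where C: "C \<ge> 0"
    "\<And>x z h. dsq (x + h, z + B x h) + dsq (x - h, z - B x h) - 2 * dsq (x, z) \<le> C * (norm h)\<^sup>2"
    using dsq_second_difference by blast
  have "dsq (gmult B p h) + dsq (gmult B p (- h)) - 2 * dsq p \<le> C * (norm h)\<^sup>2"
    if "h \<in> horizontal_plane" for p h
  proof -
    have h: "h = (fst h, 0)" using that by (simp add: horizontal_plane_def prod_eq_iff)
    have "norm h = norm (fst h)" by (subst h) (simp add: norm_Pair)
    moreover have "gmult B p h = (fst p + fst h, snd p + B (fst p) (fst h))"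
      "gmult B p (- h) = (fst p - fst h, snd p - B (fst p) (fst h))"
      using that by (simp_all add: gmult_def horizontal_plane_def B.minus_right)
    ultimately show ?thesis using C(2)[of "fst p" "fst h" "snd p"] by simp
  qed
  then show ?thesis
    unfolding h_semiconcave_def using lsc_dsq C(1) by blast
qed

end

theorem theorem1p1:
  fixes B :: "real ^ 'm \<Rightarrow> real ^ 'm \<Rightarrow> real ^ 'k"
  assumes "step2_carnot B"
  shows "h_semiconcave B UNIV (\<lambda>p. (cc_dist B p 0)\<^sup>2)"
proof -
  interpret step2_group B using assms by unfold_locales
  show ?thesis using h_semiconcave_dsq unfolding dsq_def[abs_def] .
qed

end
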